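(* Let $\alpha_0,\alpha_1\in\mathbb{C}$ and consider the system $$\frac{dx}{dt}=y,\qquad \frac{dy}{dt}=yz+\frac{2\alpha_1-1}{t^2}x+\frac{\alpha_0}{t^2},$$ $$\frac{dz}{dt}=-\frac12 z^2-\frac4t x-4y-\frac2t z+\frac{(2\alpha_1-1)(2\alpha_1-3)}{2t^2}+\frac2t .$$ The phase space $\mathcal{X}$ for this system is obtained by gluing three copies of $\mathbb{C}^3\times\mathbb{C}^*$, $$U_j\times\mathbb{C}^*\cong\mathbb{C}^3\times\mathbb{C}^*\ni(x_j,y_j,z_j,t),\qquad j=0,1,2,$$ via the following birational transformations (with $t$ unchanged): (0) $x_0=x,\quad y_0=y,\quad z_0=z$; (1) $x_1=x,\quad y_1=-\left(yz+\dfrac{2(2\alpha_1-1)x+2\alpha_0}{t^2}\right)z,\quad z_1=\dfrac1z$; (2) $x_2=x+\dfrac z2,\quad z_2=\dfrac1z$, and $$y_2=-\left(\Big(y+\frac2t x-\frac1t-\frac{4(\alpha_1-1)\alpha_1-7}{4t^2}\Big)z-\frac{2(2\alpha_1-3)tx+2(\alpha_0+1)t+4\alpha_1^2-8\alpha_1+3}{t^3}+\frac{tz+4}{4t}z^2\right)z .$$ That is, these three charts glue to a complex manifold $\mathcal{X}$ over $\mathbb{C}^*$ on which the system extends to a holomorphic vector field, being a polynomial system in $(x_j,y_j,z_j)$ (with coefficients in $\mathbb{C}(t)$, holomorphic on $\mathbb{C}^*$) in each chart. Moreover, for each fixed $t\in\mathbb{C}^*$, $$dx_i\wedge dy_i\wedge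 dz_i=dx\wedge dy\wedge dz\qquad(i=1,2).$$
   Context: $\mathbb{C}^*=\mathbb{C}\setminus\{0\}$ is the range of the time variable $t$. Gluing via the birational transformations means identifying points of different charts whenever they correspond to each other under the transformations (each of (1), (2) is an isomorphism from $\{z\neq0\}$ onto $\{z_i\neq0\}$, for each $t\in\mathbb{C}^*$). The phase space of the system is understood as the manifold fibred over $\mathbb{C}^*$ obtained by such gluing, containing the original chart $(x,y,z,t)\in\mathbb{C}^3\times\mathbb{C}^*$, on which the right-hand side of the system is polynomial in every chart. *)

theory Defs
  imports "HOL-Analysis.Analysis" "HOL-Computational_Algebra.Polynomial"
begin

section \<open>Complex manifolds\<close>

text \<open>Holomorphy in several variables is complex Frechet differentiability at each point of an
  open set: the real derivative is multiplication by a complex matrix.\<close>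

definition holomorphic_map_on :: "(complex^'n \<Rightarrow> complex^'m) \<Rightarrow> (complex^'n) set \<Rightarrow> bool" where
  "holomorphic_map_on f S \<longleftrightarrow>
     open S \<and> (\<forall>p\<in>S. \<exists>A :: complex^'n^'m. (f has_derivative (\<lambda>v. A *v v)) (at p))"

definition transition :: "('i \<Rightarrow> 'a set) \<Rightarrow> ('i \<Rightarrow> 'a \<Rightarrow> complex^'n) \<Rightarrow> 'i \<Rightarrow> 'i \<Rightarrow>
    complex^'n \<Rightarrow> complex^'n" where
  "transition U \<phi> i j = \<phi> j \<circ> inv_into (U i) (\<phi> i)"

definition complex_atlas :: "'a topology \<Rightarrow> 'i set \<Rightarrow> ('i \<Rightarrow> 'a set) \<Rightarrow>
    ('i \<Rightarrow> 'a \<Rightarrow> complex^'n) \<Rightarrow> bool" where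
  "complex_atlas X I U \<phi> \<longleftrightarrow>
     (\<forall>i\<in>I. openin X (U i) \<and> open (\<phi> i ` U i) \<and>
        homeomorphic_map (subtopology X (U i)) (top_of_set (\<phi> i ` U i)) (\<phi> i)) \<and>
     (\<Union>i\<in>I. U i) = topspace X \<and>
     (\<forall>i\<in>I. \<forall>j\<in>I. holomorphic_map_on (transition U \<phi> i j) (\<phi> i ` (U i \<inter> U j)))"

definition complex_manifold :: "'a topology \<Rightarrow> 'i set \<Rightarrow> ('i \<Rightarrow> 'a set) \<Rightarrow>
    ('i \<Rightarrow> 'a \<Rightarrow> complex^'n) \<Rightarrow> bool" where
  "complex_manifold X I U \<phi> \<longleftrightarrow>
     Hausdorff_space X \<and> second_countable X \<and> complex_atlas X I U \<phi>"

definition holomorphic_submersion_onto :: "'a topology \<Rightarrow> 'i set \<Rightarrow> ('i \<Rightarrow> 'a set) \<Rightarrow>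
    ('i \<Rightarrow> 'a \<Rightarrow> complex^'n) \<Rightarrow> ('a \<Rightarrow> complex) \<Rightarrow> complex set \<Rightarrow> bool" where
  "holomorphic_submersion_onto X I U \<phi> \<pi> B \<longleftrightarrow>
     \<pi> ` topspace X = B \<and>
     (\<forall>i\<in>I. \<forall>p\<in>\<phi> i ` U i. \<exists>D. ((\<pi> \<circ> inv_into (U i) (\<phi> i)) has_derivative D) (at p) \<and>
        (\<forall>c v. D (c *s v) = c * D v) \<and> surj D)"

text \<open>A holomorphic vector field is given by its local representatives \<open>V i\<close>, which correspond
  to each other under the differentials of the transition maps.\<close>

definition holomorphic_vector_field :: "'i set \<Rightarrow> ('i \<Rightarrow> 'a set) \<Rightarrow>
    ('i \<Rightarrow> 'a \<Rightarrow> complex^'n) \<Rightarrow> ('i \<Rightarrow> complex^'n \<Rightarrow> complex^'n) \<Rightarrow> bool" where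
  "holomorphic_vector_field I U \<phi> V \<longleftrightarrow>
     (\<forall>i\<in>I. holomorphic_map_on (V i) (\<phi> i ` U i)) \<and>
     (\<forall>i\<in>I. \<forall>j\<in>I. \<forall>p\<in>\<phi> i ` (U i \<inter> U j).
        V j (transition U \<phi> i j p) = frechet_derivative (transition U \<phi> i j) (at p) (V i p))"

definition quotient_topology :: "'a topology \<Rightarrow> ('a \<times> 'a) set \<Rightarrow> 'a set topology" where
  "quotient_topology Y r =
     topology (\<lambda>\<U>. \<U> \<subseteq> topspace Y // r \<and> openin Y {x \<in> topspace Y. r `` {x} \<in> \<U>})"


section \<open>The system and the coordinate changes\<close>

text \<open>A point \<open>(x, y, z, t)\<close> of the total space is a vector in \<^typ>\<open>complex^4\<close>, a point
  \<open>(x, y, z)\<close> of a fibre a vector in \<^typ>\<open>complex^3\<close>.\<close>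

definition fibre_part :: "complex^4 \<Rightarrow> complex^3" where
  "fibre_part p = vector [p$1, p$2, p$3]"

definition with_time :: "complex^3 \<Rightarrow> complex \<Rightarrow> complex^4" where
  "with_time v t = vector [v$1, v$2, v$3, t]"

definition rhs :: "complex \<Rightarrow> complex \<Rightarrow> complex \<Rightarrow> complex^3 \<Rightarrow> complex^3" where
  "rhs \<alpha>0 \<alpha>1 t v = (let x = v$1; y = v$2; z = v$3 in
     vector [y,
             y * z + (2*\<alpha>1 - 1) / t^2 * x + \<alpha>0 / t^2,
             - (1/2) * z^2 - 4/t * x - 4 * y - 2/t * z
               + (2*\<alpha>1 - 1) * (2*\<alpha>1 - 3) / (2 * t^2) + 2/t])"

text \<open>The non-autonomous system as a vector field on \<open>\<complex>\<^sup>3 \<times> \<complex>\<^sup>*\<close>, with \<open>dt/dt = 1\<close>.\<close>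

definition system_field :: "complex \<Rightarrow> complex \<Rightarrow> complex^4 \<Rightarrow> complex^4" where
  "system_field \<alpha>0 \<alpha>1 p = with_time (rhs \<alpha>0 \<alpha>1 (p$4) (fibre_part p)) 1"

definition change1 :: "complex \<Rightarrow> complex \<Rightarrow> complex \<Rightarrow> complex^3 \<Rightarrow> complex^3" where
  "change1 \<alpha>0 \<alpha>1 t v = (let x = v$1; y = v$2; z = v$3 in
     vector [x,
             - (y * z + (2 * (2*\<alpha>1 - 1) * x + 2*\<alpha>0) / t^2) * z,
             1 / z])"

definition change2 :: "complex \<Rightarrow> complex \<Rightarrow> complex \<Rightarrow> complex^3 \<Rightarrow> complex^3" where
  "change2 \<alpha>0 \<alpha>1 t v = (let x = v$1; y = v$2; z = v$3 in
     vector [x + z / 2,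
             - ((y + 2/t * x - 1/t - (4 * (\<alpha>1 - 1) * \<alpha>1 - 7) / (4 * t^2)) * z
                - (2 * (2*\<alpha>1 - 3) * t * x + 2 * (\<alpha>0 + 1) * t + 4 * \<alpha>1^2 - 8*\<alpha>1 + 3) / t^3
                + (t * z + 4) / (4 * t) * z^2) * z,
             1 / z])"

definition change :: "complex \<Rightarrow> complex \<Rightarrow> nat \<Rightarrow> complex \<Rightarrow> complex^3 \<Rightarrow> complex^3" where
  "change \<alpha>0 \<alpha>1 j t =
     (if j = 0 then (\<lambda>v. v) else if j = 1 then change1 \<alpha>0 \<alpha>1 t else change2 \<alpha>0 \<alpha>1 t)"

definition total_change :: "complex \<Rightarrow> complex \<Rightarrow> nat \<Rightarrow> complex^4 \<Rightarrow> complex^4" where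
  "total_change \<alpha>0 \<alpha>1 j p = with_time (change \<alpha>0 \<alpha>1 j (p$4) (fibre_part p)) (p$4)"


section \<open>The phase space\<close>

definition indices :: "nat set" where
  "indices = {0, 1, 2}"

text \<open>One copy of \<open>\<complex>\<^sup>3 \<times> \<complex>\<^sup>*\<close>.\<close>

definition chart_space :: "(complex^4) set" where
  "chart_space = {p. p$4 \<noteq> 0}"

text \<open>\<open>(j, p)\<close> is the point with coordinates \<open>p\<close> in the \<open>j\<close>-th copy. Points of two copies are
  identified if they are the images of a common \<open>r\<close> with \<open>z \<noteq> 0\<close>, where both changes of
  coordinates are defined. That this is an equivalence relation is part of the theorem.\<close>

definition glue :: "complex \<Rightarrow> complex \<Rightarrow> ((nat \<times> (complex^4)) \<times> (nat \<times> (complex^4))) set" where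
  "glue \<alpha>0 \<alpha>1 = {((j, p), (k, q)).
     j \<in> indices \<and> k \<in> indices \<and> p \<in> chart_space \<and> q \<in> chart_space \<and>
     (j = k \<and> p = q \<or>
      (\<exists>r\<in>chart_space. r$3 \<noteq> 0 \<and> p = total_change \<alpha>0 \<alpha>1 j r \<and> q = total_change \<alpha>0 \<alpha>1 k r))}"

definition phase_space :: "complex \<Rightarrow> complex \<Rightarrow> (nat \<times> (complex^4)) set topology" where
  "phase_space \<alpha>0 \<alpha>1 =
     quotient_topology (sum_topology (\<lambda>j. top_of_set chart_space) indices) (glue \<alpha>0 \<alpha>1)"

definition chart_dom :: "complex \<Rightarrow> complex \<Rightarrow> nat \<Rightarrow> (nat \<times> (complex^4)) set set" where
  "chart_dom \<alpha>0 \<alpha>1 j = (\<lambda>p. glue \<alpha>0 \<alpha>1 `` {(j, p)}) ` chart_space"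

definition chart_map :: "nat \<Rightarrow> (nat \<times> (complex^4)) set \<Rightarrow> complex^4" where
  "chart_map j c = (THE p. (j, p) \<in> c)"

definition time_proj :: "(nat \<times> (complex^4)) set \<Rightarrow> complex" where
  "time_proj c = (THE t. \<forall>(j, p)\<in>c. p$4 = t)"


section \<open>Polynomial and regular functions\<close>

text \<open>Coefficients: rational functions of \<open>t\<close> without poles in \<open>\<complex>\<^sup>*\<close>.\<close>

definition rational_holomorphic :: "(complex \<Rightarrow> complex) \<Rightarrow> bool" where
  "rational_holomorphic f \<longleftrightarrow> f holomorphic_on - {0} \<and>
     (\<exists>p q. q \<noteq> 0 \<and> (\<forall>t. t \<noteq> 0 \<and> poly q t \<noteq> 0 \<longrightarrow> f t = poly p t / poly q t))"

definition polynomial_over_time :: "(complex^4 \<Rightarrow> complex) \<Rightarrow> bool" where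
  "polynomial_over_time f \<longleftrightarrow>
     (\<exists>N c. (\<forall>a b d. rational_holomorphic (c a b d)) \<and>
        (\<forall>p\<in>chart_space. f p =
           (\<Sum>a\<le>N. \<Sum>b\<le>N. \<Sum>d\<le>(N::nat). c a b d (p$4) * p$1 ^ a * p$2 ^ b * p$3 ^ d)))"

definition polynomial3 :: "(complex^3 \<Rightarrow> complex) \<Rightarrow> bool" where
  "polynomial3 f \<longleftrightarrow>
     (\<exists>N c. \<forall>v. f v = (\<Sum>a\<le>N. \<Sum>b\<le>N. \<Sum>d\<le>(N::nat). c a b d * v$1 ^ a * v$2 ^ b * v$3 ^ d))"

definition regular_off_z :: "(complex^3 \<Rightarrow> complex) \<Rightarrow> bool" where
  "regular_off_z f \<longleftrightarrow> (\<exists>g n. polynomial3 g \<and> (\<forall>v. v$3 \<noteq> 0 \<longrightarrow> f v = g v / v$3 ^ n))"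

text \<open>An isomorphism of the affine varieties \<open>{z \<noteq> 0}\<close>, in particular a birational map of \<open>\<complex>\<^sup>3\<close>.\<close>

definition isomorphism_off_z :: "(complex^3 \<Rightarrow> complex^3) \<Rightarrow> bool" where
  "isomorphism_off_z f \<longleftrightarrow>
     bij_betw f {v. v$3 \<noteq> 0} {v. v$3 \<noteq> 0} \<and>
     (\<forall>k. regular_off_z (\<lambda>v. f v $ k)) \<and>
     (\<forall>k. regular_off_z (\<lambda>v. inv_into {v. v$3 \<noteq> 0} f v $ k))"


section \<open>Differential forms on a fibre\<close>

definition differential :: "(complex^3 \<Rightarrow> complex) \<Rightarrow> complex^3 \<Rightarrow> complex^3 \<Rightarrow> complex" where
  "differential f p = frechet_derivative f (at p)"

text \<open>Wedge product of three covectors as an alternating trilinear form, normalised so that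
  \<open>dx \<and> dy \<and> dz\<close> takes the value 1 on the standard basis.\<close>

definition wedge3 :: "(complex^3 \<Rightarrow> complex) \<Rightarrow> (complex^3 \<Rightarrow> complex) \<Rightarrow> (complex^3 \<Rightarrow> complex) \<Rightarrow>
    complex^3 \<Rightarrow> complex^3 \<Rightarrow> complex^3 \<Rightarrow> complex" where
  "wedge3 \<beta> \<gamma> \<delta> u v w =
     \<beta> u * \<gamma> v * \<delta> w + \<beta> v * \<gamma> w * \<delta> u + \<beta> w * \<gamma> u * \<delta> v
     - \<beta> u * \<gamma> w * \<delta> v - \<beta> v * \<gamma> u * \<delta> w - \<beta> w * \<gamma> v * \<delta> u"

text \<open>The 3-form \<open>df\<^sub>1 \<and> df\<^sub>2 \<and> df\<^sub>3\<close>, where \<open>f\<^sub>k\<close> are the components of \<open>f\<close>.\<close>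

definition volume_form :: "(complex^3 \<Rightarrow> complex^3) \<Rightarrow> complex^3 \<Rightarrow>
    complex^3 \<Rightarrow> complex^3 \<Rightarrow> complex^3 \<Rightarrow> complex" where
  "volume_form f p = wedge3 (differential (\<lambda>v. f v $ 1) p) (differential (\<lambda>v. f v $ 2) p)
                            (differential (\<lambda>v. f v $ 3) p)"

end

theory Submission
  imports Defs
begin

text \<open>
  Write \<open>s = 1/t\<close> and \<open>w = 1/z\<close>. Both coordinate changes replace \<open>z\<close> by \<open>w\<close>, add to \<open>x\<close> a multiple of
  \<open>z\<close>, and are affine in \<open>y\<close> with leading coefficient \<open>- z\<^sup>2\<close>. Hence each is invertible over
  \<open>z \<noteq> 0\<close> by solving for \<open>x\<close> and then for \<open>y\<close>, and its Jacobian determinant is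
  \<open>(- z\<^sup>2) * (- 1/z\<^sup>2) = 1\<close>, which gives the isomorphisms and the volume form.

  Gluing copies of an open set along isomorphisms of an open subset always yields a second countable
  space with holomorphic transition maps; the only thing that can fail is the Hausdorff property, when
  points outside the overlap have no disjoint neighbourhoods (locale \<open>gluing\<close>). Here it holds because
  on the overlap the third coordinate of one chart times a polynomial in the two coordinate vectors is
  the constant 1: \<open>z * z\<^sub>i = 1\<close> between the charts 0 and \<open>i\<close>, and \<open>z\<^sub>1 * 2 (x\<^sub>2 - x\<^sub>1) = 1\<close>
  between the charts 1 and 2. So a family of common points cannot converge in both charts while its
  third coordinate tends to 0 (\<open>separated_charts\<close>).

  Pushed forward, the vector field is a priori only a Laurent polynomial in \<open>w\<close>. It is a polynomial for
  the following reason. In chart 1, with coordinates \<open>(X, Y, w)\<close>, there are an affine function \<open>L\<close> of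
  \<open>X\<close> and \<open>M = Y w + L\<close> with \<open>y = - M w\<close>; in chart 2, \<open>M = Y w - L\<close> and \<open>y = - z\<^sup>2/4 + P - M w\<close> with
  \<open>P\<close> affine in \<open>X\<close>. The part of \<open>dz/dt\<close> that is singular at \<open>w = 0\<close> is \<open>- z\<^sup>2/2 - 2 s z\<close> in chart 1
  and \<open>z\<^sup>2/2\<close> in chart 2, and the rest, \<open>K\<close>, is a polynomial in the new coordinates. Therefore
  \<open>dw/dt = - w\<^sup>2 dz/dt\<close> is a polynomial with value \<open>1/2\<close> or \<open>- 1/2\<close> at \<open>w = 0\<close>: charts 1 and 2 cover
  the solutions with simple poles of \<open>z\<close> of residue 2 and \<open>- 2\<close>. In \<open>dY/dt\<close> the singular terms cancel
  and leave \<open>K (Y w + M)\<close> plus terms linear in \<open>M\<close> and \<open>Y\<close>. The resulting fields are \<open>field1\<close> and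
  \<open>field2\<close>; that they are the push-forwards is \<open>system_field_push1\<close> and \<open>system_field_push2\<close>.
\<close>

section \<open>Holomorphic maps in several variables\<close>

lemma holomorphic_map_on_open: "holomorphic_map_on f S \<Longrightarrow> open S"
  by (simp add: holomorphic_map_on_def)

lemma holomorphic_map_on_differentiable:
  "holomorphic_map_on f S \<Longrightarrow> p \<in> S \<Longrightarrow> f differentiable (at p)"
  unfolding holomorphic_map_on_def differentiable_def by blast

lemma holomorphic_map_on_continuous: "holomorphic_map_on f S \<Longrightarrow> continuous_on S f"
  by (intro differentiable_imp_continuous_on differentiable_at_imp_differentiable_on)
     (rule holomorphic_map_on_differentiable)

lemma holomorphic_map_on_cong:
  assumes "\<And>p. p \<in> S \<Longrightarrow> f p = g p" and "holomorphic_map_on f S"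
  shows "holomorphic_map_on g S"
  unfolding holomorphic_map_on_def
proof (intro conjI ballI)
  show S: "open S" using assms(2) by (rule holomorphic_map_on_open)
  fix p assume p: "p \<in> S"
  then obtain A where "(f has_derivative (\<lambda>v. A *v v)) (at p)"
    using assms(2) unfolding holomorphic_map_on_def by blast
  then have "(g has_derivative (\<lambda>v. A *v v)) (at p)"
    by (rule has_derivative_transform_within_open[OF _ S p]) (rule assms(1))
  then show "\<exists>A. (g has_derivative (\<lambda>v. A *v v)) (at p)" by blast
qed

lemma holomorphic_map_on_id: "open S \<Longrightarrow> holomorphic_map_on (\<lambda>p. p) S"
  unfolding holomorphic_map_on_def
  by (auto simp: matrix_vector_mul_lid[abs_def] intro!: exI[of _ "mat 1"])

lemma holomorphic_map_on_compose:
  assumes f: "holomorphic_map_on f S" and g: "holomorphic_map_on g T" and "f ` S \<subseteq> T"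
  shows "holomorphic_map_on (g \<circ> f) S"
  unfolding holomorphic_map_on_def
proof (intro conjI ballI)
  show "open S" using f by (rule holomorphic_map_on_open)
  fix p assume p: "p \<in> S"
  obtain A where A: "(f has_derivative (\<lambda>v. A *v v)) (at p)"
    using f p unfolding holomorphic_map_on_def by blast
  obtain B where B: "(g has_derivative (\<lambda>v. B *v v)) (at (f p))"
    using g p assms(3) unfolding holomorphic_map_on_def by blast
  have "(g \<circ> f has_derivative (\<lambda>v. (B ** A) *v v)) (at p)"
    using diff_chain_at[OF A B] by (simp add: o_def matrix_vector_mul_assoc)
  then show "\<exists>A. (g \<circ> f has_derivative (\<lambda>v. A *v v)) (at p)" by blast
qed

text \<open>Componentwise differentiation with respect to the real basis of \<open>\<complex>\<^sup>n\<close>, whose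
  elements are \<open>axis k u\<close> with \<open>u\<close> equal to 1 or \<open>\<i>\<close>, reduces to the complex components.\<close>

lemma has_derivative_vec_componentwise:
  fixes f :: "'a::real_normed_vector \<Rightarrow> complex^'n"
  assumes "\<And>k. ((\<lambda>p. f p $ k) has_derivative D k) (at p)"
  shows "(f has_derivative (\<lambda>v. \<chi> k. D k v)) (at p)"
proof (subst has_derivative_componentwise_within, intro ballI)
  fix b :: "complex^'n" assume "b \<in> Basis"
  then obtain k u where "b = axis k u" by (auto simp: Basis_vec_def)
  then show "((\<lambda>p. f p \<bullet> b) has_derivative (\<lambda>v. (\<chi> k. D k v) \<bullet> b)) (at p)"
    using has_derivative_inner_left[OF assms[of k], of u] by (simp add: inner_axis)
qed

section \<open>Complex directional derivatives\<close>

text \<open>A value of the Frechet derivative, required to be complex homogeneous. The rules below compute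
  that value by unification, and at the same time they establish holomorphy; so one calculus
  serves the charts, the vector field and the volume form.\<close>

definition dir_deriv :: "(complex^'n \<Rightarrow> complex) \<Rightarrow> complex^'n \<Rightarrow> complex^'n \<Rightarrow> complex \<Rightarrow> bool" where
  "dir_deriv f p v d \<longleftrightarrow>
     (\<exists>D. (f has_derivative D) (at p) \<and> (\<forall>c u. D (c *s u) = c * D u) \<and> D v = d)"

named_theorems dir_deriv_intros

lemma dir_deriv_const [dir_deriv_intros]: "dir_deriv (\<lambda>p. c) p v 0"
  unfolding dir_deriv_def by (intro exI[of _ "\<lambda>_. 0"]) auto

lemma dir_deriv_nth [dir_deriv_intros]: "dir_deriv (\<lambda>p. p $ k) p v (v $ k)"
  unfolding dir_deriv_def
  by (intro exI[of _ "\<lambda>v. v $ k"]) (auto intro: bounded_linear_imp_has_derivative)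

lemma dir_deriv_minus [dir_deriv_intros]: "dir_deriv f p v a \<Longrightarrow> dir_deriv (\<lambda>p. - f p) p v (- a)"
  unfolding dir_deriv_def
proof (elim exE conjE)
  fix D assume "(f has_derivative D) (at p)" "\<forall>c u. D (c *s u) = c * D u" "D v = a"
  then show "\<exists>D. ((\<lambda>p. - f p) has_derivative D) (at p) \<and> (\<forall>c u. D (c *s u) = c * D u) \<and> D v = - a"
    by (intro exI[of _ "\<lambda>u. - D u"]) (auto intro: derivative_intros)
qed

lemma dir_deriv_add [dir_deriv_intros]:
  "dir_deriv f p v a \<Longrightarrow> dir_deriv g p v b \<Longrightarrow> dir_deriv (\<lambda>p. f p + g p) p v (a + b)"
  unfolding dir_deriv_def
proof (elim exE conjE)
  fix D E assume "(f has_derivative D) (at p)" "\<forall>c u. D (c *s u) = c * D u" "D v = a"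
    "(g has_derivative E) (at p)" "\<forall>c u. E (c *s u) = c * E u" "E v = b"
  then show "\<exists>D. ((\<lambda>p. f p + g p) has_derivative D) (at p) \<and>
      (\<forall>c u. D (c *s u) = c * D u) \<and> D v = a + b"
    by (intro exI[of _ "\<lambda>u. D u + E u"]) (auto intro: derivative_intros simp: algebra_simps)
qed

lemma dir_deriv_diff [dir_deriv_intros]:
  "dir_deriv f p v a \<Longrightarrow> dir_deriv g p v b \<Longrightarrow> dir_deriv (\<lambda>p. f p - g p) p v (a - b)"
  using dir_deriv_add[of f p v a "\<lambda>p. - g p" "- b"] dir_deriv_minus[of g p v b] by simp

lemma dir_deriv_mult [dir_deriv_intros]:
  "dir_deriv f p v a \<Longrightarrow> dir_deriv g p v b \<Longrightarrow> dir_deriv (\<lambda>p. f p * g p) p v (f p * b + a * g p)"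
  unfolding dir_deriv_def
proof (elim exE conjE)
  fix D E assume "(f has_derivative D) (at p)" "\<forall>c u. D (c *s u) = c * D u" "D v = a"
    "(g has_derivative E) (at p)" "\<forall>c u. E (c *s u) = c * E u" "E v = b"
  then show "\<exists>D. ((\<lambda>p. f p * g p) has_derivative D) (at p) \<and>
      (\<forall>c u. D (c *s u) = c * D u) \<and> D v = f p * b + a * g p"
    by (intro exI[of _ "\<lambda>u. f p * E u + D u * g p"]) (auto intro: has_derivative_mult simp: distrib_left)
qed

lemma dir_deriv_inverse:
  "dir_deriv f p v a \<Longrightarrow> f p \<noteq> 0 \<Longrightarrow> dir_deriv (\<lambda>p. inverse (f p)) p v (- a / f p ^ 2)"
  unfolding dir_deriv_def
proof (elim exE conjE)
  fix D assume "(f has_derivative D) (at p)" "\<forall>c u. D (c *s u) = c * D u" "D v = a" "f p \<noteq> 0"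
  then show "\<exists>D. ((\<lambda>p. inverse (f p)) has_derivative D) (at p) \<and>
      (\<forall>c u. D (c *s u) = c * D u) \<and> D v = - a / f p ^ 2"
    by (intro exI[of _ "\<lambda>u. - (inverse (f p) * D u * inverse (f p))"] conjI Deriv.has_derivative_inverse)
       (auto simp: field_simps power2_eq_square)
qed

text \<open>The derivative is again written with \<open>1 / p $ k\<close>, so that after differentiation all identities
  are polynomial in \<open>s = 1/t\<close> and \<open>w = 1/z\<close> and can be proved in a commutative ring.\<close>

lemma dir_deriv_recip [dir_deriv_intros]:
  "p $ k \<noteq> 0 \<Longrightarrow> dir_deriv (\<lambda>p. 1 / p $ k) p v (- v $ k * (1 / p $ k) ^ 2)"
  using dir_deriv_inverse[OF dir_deriv_nth] by (simp add: divide_inverse power_inverse)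

lemma dir_deriv_power [dir_deriv_intros]:
  "dir_deriv f p v a \<Longrightarrow> dir_deriv (\<lambda>p. f p ^ n) p v (of_nat n * f p ^ (n - 1) * a)"
proof (induction n)
  case 0
  then show ?case using dir_deriv_const[of 1] by simp
next
  case (Suc n)
  then show ?case using dir_deriv_mult[OF Suc.prems Suc.IH[OF Suc.prems]]
    by (cases n) (simp_all add: algebra_simps)
qed

lemma dir_deriv_eq: "dir_deriv f p v a \<Longrightarrow> a = b \<Longrightarrow> dir_deriv f p v b" by simp

lemma dir_deriv_transform_within_open:
  assumes "dir_deriv f p v d" "open S" "p \<in> S" "\<And>q. q \<in> S \<Longrightarrow> f q = g q"
  shows "dir_deriv g p v d"
  using assms unfolding dir_deriv_def by (metis has_derivative_transform_within_open)

lemma open_nonzero_coordinate: "open {p :: complex^'n. p $ k \<noteq> 0}"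
  by (intro open_Collect_neq continuous_intros)

lemma dir_deriv_frechet_derivative: "dir_deriv f p v a \<Longrightarrow> frechet_derivative f (at p) v = a"
  unfolding dir_deriv_def using frechet_derivative_at by metis

lemma frechet_derivative_componentwise:
  fixes f :: "complex^'n \<Rightarrow> complex^'m"
  assumes "\<And>k. dir_deriv (\<lambda>p. f p $ k) p v (d $ k)"
  shows "frechet_derivative f (at p) v = d"
proof -
  obtain D where D: "\<And>k. ((\<lambda>p. f p $ k) has_derivative D k) (at p)" "\<And>k. D k v = d $ k"
    using assms unfolding dir_deriv_def by metis
  have "frechet_derivative f (at p) = (\<lambda>v. \<chi> k. D k v)"
    using has_derivative_vec_componentwise[of f D p, OF D(1)] by (rule frechet_derivative_at[symmetric])
  then show ?thesis by (simp add: D(2))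
qed

text \<open>The direction 0 suffices: a derivative in one direction comes with the whole complex linear
  differential, whose values on the axes form the required matrix.\<close>

lemma holomorphic_map_onI:
  fixes f :: "complex^'n \<Rightarrow> complex^'m"
  assumes "open S" and "\<And>p k. p \<in> S \<Longrightarrow> \<exists>d. dir_deriv (\<lambda>p. f p $ k) p 0 d"
  shows "holomorphic_map_on f S"
  unfolding holomorphic_map_on_def
proof (intro conjI ballI)
  fix p assume "p \<in> S"
  then obtain D where D: "\<And>k. ((\<lambda>p. f p $ k) has_derivative D k) (at p)"
      "\<And>k c u. D k (c *s u) = c * D k u"
    using assms(2) unfolding dir_deriv_def by metis
  have lin: "linear (D k)" for k using D(1) by (rule has_derivative_linear)
  have "D k v = (\<Sum>j\<in>UNIV. D k (axis j 1) * v $ j)" for k v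
  proof -
    have "D k v = D k (\<Sum>j\<in>UNIV. (v $ j) *s axis j 1)" by (simp add: basis_expansion)
    also have "\<dots> = (\<Sum>j\<in>UNIV. D k (axis j 1) * v $ j)"
      by (simp add: linear_sum[OF lin] D(2) mult.commute)
    finally show ?thesis .
  qed
  note expand = this
  have eq: "(\<lambda>v. \<chi> k. D k v) = (*v) (\<chi> k j. D k (axis j 1))"
    by (simp add: fun_eq_iff matrix_vector_mult_def flip: expand)
  show "\<exists>A. (f has_derivative (*v) A) (at p)"
    using has_derivative_vec_componentwise[of f D p, OF D(1)] unfolding eq by (rule exI)
qed (fact assms(1))

section \<open>Quotient topologies\<close>

lemma istopology_quotient:
  "istopology (\<lambda>\<U>. \<U> \<subseteq> topspace Y // r \<and> openin Y {x \<in> topspace Y. r `` {x} \<in> \<U>})"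
  unfolding istopology_def
proof (intro conjI allI impI)
  fix \<A> \<B>
  assume "\<A> \<subseteq> topspace Y // r \<and> openin Y {x \<in> topspace Y. r `` {x} \<in> \<A>}"
     and "\<B> \<subseteq> topspace Y // r \<and> openin Y {x \<in> topspace Y. r `` {x} \<in> \<B>}"
  moreover have "{x \<in> topspace Y. r `` {x} \<in> \<A> \<inter> \<B>} =
      {x \<in> topspace Y. r `` {x} \<in> \<A>} \<inter> {x \<in> topspace Y. r `` {x} \<in> \<B>}" by auto
  ultimately show "\<A> \<inter> \<B> \<subseteq> topspace Y // r" "openin Y {x \<in> topspace Y. r `` {x} \<in> \<A> \<inter> \<B>}"
    by (auto simp: openin_Int)
next
  fix \<K> assume *: "\<forall>\<A>\<in>\<K>. \<A> \<subseteq> topspace Y // r \<and> openin Y {x \<in> topspace Y. r `` {x} \<in> \<A>}"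
  then show "\<Union>\<K> \<subseteq> topspace Y // r" by blast
  have "{x \<in> topspace Y. r `` {x} \<in> \<Union>\<K>} = (\<Union>\<A>\<in>\<K>. {x \<in> topspace Y. r `` {x} \<in> \<A>})" by auto
  then show "openin Y {x \<in> topspace Y. r `` {x} \<in> \<Union>\<K>}" using * by auto
qed

lemma openin_quotient_topology:
  "openin (quotient_topology Y r) \<U> \<longleftrightarrow>
     \<U> \<subseteq> topspace Y // r \<and> openin Y {x \<in> topspace Y. r `` {x} \<in> \<U>}"
  unfolding quotient_topology_def by (simp add: istopology_quotient)

lemma topspace_quotient_topology: "topspace (quotient_topology Y r) = topspace Y // r"
proof (rule antisym)
  show "topspace (quotient_topology Y r) \<subseteq> topspace Y // r"
    by (metis openin_quotient_topology openin_topspace)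
  have "{x \<in> topspace Y. r `` {x} \<in> topspace Y // r} = topspace Y" by (auto intro: quotientI)
  then have "openin (quotient_topology Y r) (topspace Y // r)"
    by (simp add: openin_quotient_topology)
  then show "topspace Y // r \<subseteq> topspace (quotient_topology Y r)" by (rule openin_subset)
qed

section \<open>Gluing copies of an open set along isomorphisms\<close>

text \<open>\<open>\<Phi> j\<close> maps reference coordinates on the overlap \<open>W\<close> to those of the chart \<open>j\<close>, and \<open>\<Psi> j\<close> is its
  inverse, so that the transition from \<open>j\<close> to \<open>k\<close> is \<open>\<Phi> k \<circ> \<Psi> j\<close>. All overlaps of distinct charts are
  the same set \<open>W\<close>, and the transitions satisfy the cocycle condition by construction.
  Condition \<open>separated\<close> says that a point outside the overlap in one chart and any point of another
  chart have neighbourhoods without common points.\<close>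

locale gluing =
  fixes I :: "'i set" and S W :: "(complex^'n) set"
    and \<Phi> \<Psi> :: "'i \<Rightarrow> complex^'n \<Rightarrow> complex^'n"
  assumes countable_I: "countable I"
    and open_S: "open S" and W_S: "W \<subseteq> S"
    and \<Phi>_hol: "j \<in> I \<Longrightarrow> holomorphic_map_on (\<Phi> j) W"
    and \<Psi>_hol: "j \<in> I \<Longrightarrow> holomorphic_map_on (\<Psi> j) W"
    and \<Phi>_W: "j \<in> I \<Longrightarrow> r \<in> W \<Longrightarrow> \<Phi> j r \<in> W"
    and \<Psi>_W: "j \<in> I \<Longrightarrow> p \<in> W \<Longrightarrow> \<Psi> j p \<in> W"
    and \<Psi>_\<Phi>: "j \<in> I \<Longrightarrow> r \<in> W \<Longrightarrow> \<Psi> j (\<Phi> j r) = r"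
    and \<Phi>_\<Psi>: "j \<in> I \<Longrightarrow> p \<in> W \<Longrightarrow> \<Phi> j (\<Psi> j p) = p"
    and separated: "j \<in> I \<Longrightarrow> k \<in> I \<Longrightarrow> j \<noteq> k \<Longrightarrow> p \<in> S - W \<Longrightarrow> q \<in> S \<Longrightarrow>
      \<exists>A B. open A \<and> open B \<and> p \<in> A \<and> q \<in> B \<and> (\<forall>r\<in>W. \<not> (\<Phi> j r \<in> A \<and> \<Phi> k r \<in> B))"
begin

definition rel :: "(('i \<times> (complex^'n)) \<times> ('i \<times> (complex^'n))) set" where
  "rel = {((j, p), (k, q)). j \<in> I \<and> k \<in> I \<and> p \<in> S \<and> q \<in> S \<and>
     (j = k \<and> p = q \<or> (\<exists>r\<in>W. p = \<Phi> j r \<and> q = \<Phi> k r))}"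

definition glued :: "('i \<times> (complex^'n)) set topology" where
  "glued = quotient_topology (sum_topology (\<lambda>j. top_of_set S) I) rel"

definition pt :: "'i \<Rightarrow> complex^'n \<Rightarrow> ('i \<times> (complex^'n)) set" where
  "pt j p = rel `` {(j, p)}"

definition patch :: "'i \<Rightarrow> ('i \<times> (complex^'n)) set set" where
  "patch j = pt j ` S"

definition chart :: "'i \<Rightarrow> ('i \<times> (complex^'n)) set \<Rightarrow> complex^'n" where
  "chart j c = (THE p. (j, p) \<in> c)"

text \<open>Reference coordinates are determined by coordinates in a chart; with the existential quantifier
  eliminated, symmetry and transitivity are immediate.\<close>

lemma rel_iff:
  "((j, p), (k, q)) \<in> rel \<longleftrightarrow> j \<in> I \<and> k \<in> I \<and> p \<in> S \<and> q \<in> S \<and>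
     (j = k \<and> p = q \<or> p \<in> W \<and> q \<in> W \<and> \<Psi> j p = \<Psi> k q)"
proof -
  have "(\<exists>r\<in>W. p = \<Phi> j r \<and> q = \<Phi> k r) \<longleftrightarrow> p \<in> W \<and> q \<in> W \<and> \<Psi> j p = \<Psi> k q"
    if "j \<in> I" "k \<in> I"
    using that by (metis \<Phi>_W \<Psi>_W \<Phi>_\<Psi> \<Psi>_\<Phi>)
  then show ?thesis unfolding rel_def by auto
qed

lemma rel_same_chart: "((j, p), (j, q)) \<in> rel \<longleftrightarrow> j \<in> I \<and> p \<in> S \<and> p = q"
  by (metis rel_iff \<Phi>_\<Psi>)

lemma equiv_rel: "equiv (I \<times> S) rel"
proof (rule equivI)
  show "rel \<subseteq> (I \<times> S) \<times> (I \<times> S)" by (auto simp: rel_def)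
  show "refl_on (I \<times> S) rel" by (auto simp: refl_on_def rel_iff)
  show "sym rel" by (auto simp: sym_def rel_iff)
  show "trans rel" by (auto simp: trans_def rel_iff)
qed

lemma pt_eq_iff:
  assumes "j \<in> I" "k \<in> I" "p \<in> S" "q \<in> S"
  shows "pt j p = pt k q \<longleftrightarrow> j = k \<and> p = q \<or> p \<in> W \<and> q \<in> W \<and> \<Psi> j p = \<Psi> k q"
  using eq_equiv_class_iff[OF equiv_rel, of "(j, p)" "(k, q)"] assms
  by (simp add: pt_def rel_iff)

lemma pt_inj: "j \<in> I \<Longrightarrow> p \<in> S \<Longrightarrow> q \<in> S \<Longrightarrow> pt j p = pt j q \<longleftrightarrow> p = q"
  by (metis pt_eq_iff \<Phi>_\<Psi>)

lemma pt_transition: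
  "j \<in> I \<Longrightarrow> k \<in> I \<Longrightarrow> p \<in> W \<Longrightarrow> pt j p = pt k (\<Phi> k (\<Psi> j p))"
  using W_S by (subst pt_eq_iff) (auto simp: \<Phi>_W \<Psi>_W \<Psi>_\<Phi> subset_iff)

lemma chart_pt: "j \<in> I \<Longrightarrow> p \<in> S \<Longrightarrow> chart j (pt j p) = p"
  by (simp add: chart_def pt_def rel_same_chart)

lemma chart_patch: "j \<in> I \<Longrightarrow> chart j ` patch j = S"
  by (simp add: patch_def image_image chart_pt)

lemma inv_into_chart: "j \<in> I \<Longrightarrow> p \<in> S \<Longrightarrow> inv_into (patch j) (chart j) p = pt j p"
  by (rule inv_into_f_eq) (auto simp: patch_def chart_pt inj_on_def)

text \<open>Points of two charts are identified only through \<open>W\<close>, and \<open>\<Phi> k \<circ> \<Psi> j\<close> maps \<open>W\<close> onto \<open>W\<close>.\<close>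

lemma overlap:
  assumes "j \<in> I" "k \<in> I" "j \<noteq> k" shows "patch j \<inter> patch k = pt j ` W"
proof (intro equalityI subsetI)
  fix c assume "c \<in> patch j \<inter> patch k"
  then show "c \<in> pt j ` W" using assms by (auto simp: patch_def pt_eq_iff)
next
  fix c assume "c \<in> pt j ` W"
  then obtain p where p: "p \<in> W" "c = pt j p" by blast
  have "\<Phi> k (\<Psi> j p) \<in> S"
    using assms W_S p by (auto simp: \<Phi>_W \<Psi>_W subset_iff)
  moreover have "c = pt k (\<Phi> k (\<Psi> j p))"
    unfolding p(2) using assms(1,2) p(1) by (rule pt_transition)
  ultimately show "c \<in> patch j \<inter> patch k" using p W_S by (auto simp: patch_def)
qed

lemma chart_overlap:
  "j \<in> I \<Longrightarrow> k \<in> I \<Longrightarrow> chart j ` (patch j \<inter> patch k) = (if j = k then S else W)"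
  using W_S by (auto simp: overlap chart_patch image_image chart_pt subset_iff image_iff)

lemma transition_same:
  "j \<in> I \<Longrightarrow> p \<in> S \<Longrightarrow> transition patch chart j j p = p"
  by (simp add: transition_def inv_into_chart chart_pt)

lemma transition_eq:
  assumes "j \<in> I" "k \<in> I" "p \<in> W"
  shows "transition patch chart j k p = \<Phi> k (\<Psi> j p)"
  using assms W_S
  by (auto simp: transition_def inv_into_chart pt_transition[of j k] chart_pt \<Phi>_W \<Psi>_W subset_iff)

lemma holomorphic_\<Phi>_\<Psi>:
  "j \<in> I \<Longrightarrow> k \<in> I \<Longrightarrow> holomorphic_map_on (\<Phi> k \<circ> \<Psi> j) W"
  by (rule holomorphic_map_on_compose[OF \<Psi>_hol \<Phi>_hol]) (auto simp: \<Psi>_W)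

lemma holomorphic_transition:
  assumes "j \<in> I" "k \<in> I"
  shows "holomorphic_map_on (transition patch chart j k) (chart j ` (patch j \<inter> patch k))"
proof (cases "j = k")
  case True
  then show ?thesis using assms
    by (auto simp: chart_patch transition_same open_S intro: holomorphic_map_on_cong[OF _ holomorphic_map_on_id])
next
  case False
  then show ?thesis using assms
    by (auto simp: chart_overlap transition_eq intro: holomorphic_map_on_cong[OF _ holomorphic_\<Phi>_\<Psi>])
qed

lemma topspace_glued: "topspace glued = (I \<times> S) // rel"
  by (simp add: glued_def topspace_quotient_topology)

lemma Union_patch: "(\<Union>j\<in>I. patch j) = topspace glued"
  by (auto simp: topspace_glued quotient_def patch_def pt_def)

text \<open>Reduces openness in the quotient to openness in \<open>\<complex>\<^sup>n\<close>, chart by chart; the disjoint union of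
  the copies is not mentioned afterwards.\<close>

lemma openin_glued_iff:
  "openin glued \<U> \<longleftrightarrow> \<U> \<subseteq> topspace glued \<and> (\<forall>j\<in>I. open {p \<in> S. pt j p \<in> \<U>})"
proof -
  have "{p. (j, p) \<in> {x \<in> topspace (sum_topology (\<lambda>j. top_of_set S) I). rel `` {x} \<in> \<U>}}
      = {p \<in> S. pt j p \<in> \<U>}" if "j \<in> I" for j
    using that by (auto simp: pt_def)
  then show ?thesis
    using open_S unfolding topspace_glued unfolding glued_def openin_quotient_topology openin_sum_topology
    by (auto simp: openin_open_eq pt_def)
qed

text \<open>The key property of the gluing: the trace of an open subset of chart \<open>j\<close> in another chart \<open>k\<close> is its
  preimage under the transition map, which is continuous on the open set \<open>W\<close>. So the charts are open
  embeddings.\<close>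

lemma open_pt_image:
  assumes "j \<in> I" "open A" "A \<subseteq> S"
  shows "openin glued (pt j ` A)"
  unfolding openin_glued_iff
proof (intro conjI ballI)
  show "pt j ` A \<subseteq> topspace glued" using assms Union_patch by (force simp: patch_def)
  fix k assume k: "k \<in> I"
  show "open {p \<in> S. pt k p \<in> pt j ` A}"
  proof (cases "k = j")
    case True
    then have "{p \<in> S. pt k p \<in> pt j ` A} = A" using assms pt_inj by auto
    then show ?thesis using assms by simp
  next
    case False
    note hol = holomorphic_\<Phi>_\<Psi>[OF k assms(1)]
    have "{p \<in> S. pt k p \<in> pt j ` A} = W \<inter> (\<Phi> j \<circ> \<Psi> k) -` A"
    proof (intro equalityI subsetI)
      fix p assume "p \<in> {p \<in> S. pt k p \<in> pt j ` A}"
      then obtain q where "p \<in> S" "q \<in> A" "pt k p = pt j q" by auto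
      then show "p \<in> W \<inter> (\<Phi> j \<circ> \<Psi> k) -` A"
        using assms k False by (auto simp: pt_eq_iff subset_iff \<Phi>_\<Psi>)
    next
      fix p assume "p \<in> W \<inter> (\<Phi> j \<circ> \<Psi> k) -` A"
      then show "p \<in> {p \<in> S. pt k p \<in> pt j ` A}"
        using W_S pt_transition[OF k assms(1)] by auto
    qed
    moreover have "open (W \<inter> (\<Phi> j \<circ> \<Psi> k) -` A)"
      by (rule continuous_open_preimage[OF holomorphic_map_on_continuous[OF hol]
            holomorphic_map_on_open[OF hol] assms(2)])
    ultimately show ?thesis by simp
  qed
qed

lemma openin_patch: "j \<in> I \<Longrightarrow> openin glued (patch j)"
  unfolding patch_def by (rule open_pt_image) (auto simp: open_S)

lemma homeomorphic_chart:
  assumes "j \<in> I"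
  shows "homeomorphic_map (subtopology glued (patch j)) (top_of_set S) (chart j)"
proof -
  have ts: "topspace (subtopology glued (patch j)) = patch j"
    using openin_subset[OF openin_patch[OF assms]] by auto
  have "continuous_map (subtopology glued (patch j)) (top_of_set S) (chart j)"
    unfolding continuous_map_def ts
  proof (intro conjI allI impI)
    show "chart j \<in> patch j \<rightarrow> topspace (top_of_set S)"
      using chart_patch[OF assms] by auto
    fix A assume "openin (top_of_set S) A"
    then have A: "open A" "A \<subseteq> S" using open_S by (auto simp: openin_open_eq)
    have "{c \<in> patch j. chart j c \<in> A} = pt j ` A"
      using A(2) assms by (auto simp: patch_def chart_pt)
    then show "openin (subtopology glued (patch j)) {c \<in> patch j. chart j c \<in> A}"
      using open_pt_image[OF assms A] A(2)
      by (simp add: openin_open_subtopology openin_patch assms) (auto simp: patch_def)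
  qed
  moreover have "continuous_map (top_of_set S) (subtopology glued (patch j)) (pt j)"
    unfolding continuous_map_in_subtopology
  proof
    show "continuous_map (top_of_set S) glued (pt j)"
      using assms Union_patch open_S
      by (auto simp: continuous_map_def openin_glued_iff openin_open_eq patch_def)
    show "pt j \<in> topspace (top_of_set S) \<rightarrow> patch j" by (auto simp: patch_def)
  qed
  ultimately have "homeomorphic_maps (subtopology glued (patch j)) (top_of_set S) (chart j) (pt j)"
    unfolding homeomorphic_maps_def ts using assms by (auto simp: patch_def chart_pt)
  then show ?thesis by (rule homeomorphic_maps_imp_map)
qed

lemma complex_atlas_glued: "complex_atlas glued I patch chart"
  unfolding complex_atlas_def
  by (simp add: openin_patch homeomorphic_chart chart_patch open_S Union_patch holomorphic_transition)

text \<open>A countable basis of \<open>\<complex>\<^sup>n\<close>, transported by each of the countably many charts, is a countable basis.\<close>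

lemma second_countable_glued: "second_countable glued"
proof -
  obtain B :: "(complex^'n) set set" where B: "countable B" "topological_basis B"
    using ex_countable_basis by blast
  let ?\<B> = "(\<Union>j\<in>I. (\<lambda>A. pt j ` (A \<inter> S)) ` B)"
  have "countable ?\<B>" using B(1) countable_I by blast
  moreover have "\<forall>V\<in>?\<B>. openin glued V"
    using open_S topological_basis_open[OF B(2)] by (auto intro!: open_pt_image open_Int)
  moreover have "\<exists>V\<in>?\<B>. c \<in> V \<and> V \<subseteq> \<U>" if "openin glued \<U>" "c \<in> \<U>" for \<U> c
  proof -
    have "c \<in> topspace glued" using openin_subset[OF that(1)] that(2) by (rule subsetD)
    then obtain j p where jp: "j \<in> I" "p \<in> S" "c = pt j p"
      using Union_patch unfolding patch_def by blast
    then have "open {p \<in> S. pt j p \<in> \<U>}" "p \<in> {p \<in> S. pt j p \<in> \<U>}"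
      using that by (auto simp: openin_glued_iff)
    then obtain A where A: "A \<in> B" "p \<in> A" "A \<subseteq> {p \<in> S. pt j p \<in> \<U>}"
      by (rule topological_basisE[OF B(2)])
    have "pt j ` (A \<inter> S) \<in> ?\<B>" using jp(1) A(1) by blast
    moreover have "c \<in> pt j ` (A \<inter> S)" "pt j ` (A \<inter> S) \<subseteq> \<U>" using A jp by auto
    ultimately show ?thesis by blast
  qed
  ultimately show ?thesis
    unfolding second_countable_def by (intro exI[of _ ?\<B>] conjI allI impI) simp_all
qed

text \<open>The neighbourhoods of \<open>separated\<close> have disjoint images, because a common point would be the image
  of some \<open>r\<close> in \<open>W\<close>.\<close>

lemma separated_pt:
  assumes "j \<in> I" "k \<in> I" "j \<noteq> k" "p \<in> S - W" "q \<in> S"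
  shows "\<exists>\<U> \<V>. openin glued \<U> \<and> openin glued \<V> \<and> pt j p \<in> \<U> \<and> pt k q \<in> \<V> \<and> disjnt \<U> \<V>"
proof -
  obtain A B where AB: "open A" "open B" "p \<in> A" "q \<in> B"
    "\<forall>r\<in>W. \<not> (\<Phi> j r \<in> A \<and> \<Phi> k r \<in> B)"
    using separated[OF assms] by blast
  have "pt j p' \<noteq> pt k q'" if "p' \<in> A \<inter> S" "q' \<in> B \<inter> S" for p' q'
  proof
    assume "pt j p' = pt k q'"
    then have W: "p' \<in> W" "q' \<in> W" "\<Psi> j p' = \<Psi> k q'"
      using that assms(1-3) by (auto simp: pt_eq_iff)
    then have "\<Phi> j (\<Psi> j p') = p'" "\<Phi> k (\<Psi> j p') = q'"
      using \<Phi>_\<Psi>[OF assms(1), of p'] \<Phi>_\<Psi>[OF assms(2), of q'] by simp_all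
    then show False using AB(5) W(1) assms(1) \<Psi>_W that by auto
  qed
  then have "disjnt (pt j ` (A \<inter> S)) (pt k ` (B \<inter> S))"
    unfolding disjnt_iff by blast
  then show ?thesis
    using assms AB open_S
    by (intro exI[of _ "pt j ` (A \<inter> S)"] exI[of _ "pt k ` (B \<inter> S)"]) (auto intro!: open_pt_image)
qed

lemma separated_pt_same_chart:
  assumes "j \<in> I" "p \<in> S" "q \<in> S" "p \<noteq> q"
  shows "\<exists>\<U> \<V>. openin glued \<U> \<and> openin glued \<V> \<and> pt j p \<in> \<U> \<and> pt j q \<in> \<V> \<and> disjnt \<U> \<V>"
proof -
  obtain A B where AB: "open A" "open B" "p \<in> A" "q \<in> B" "A \<inter> B = {}"
    using hausdorff[OF assms(4)] by blast
  have "disjnt (pt j ` (A \<inter> S)) (pt j ` (B \<inter> S))"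
    using AB(5) assms(1) pt_inj unfolding disjnt_iff by blast
  then show ?thesis
    using assms AB open_S
    by (intro exI[of _ "pt j ` (A \<inter> S)"] exI[of _ "pt j ` (B \<inter> S)"]) (auto intro!: open_pt_image)
qed

text \<open>Two points in a common chart are separated there, as \<open>\<complex>\<^sup>n\<close> is Hausdorff. Otherwise they lie
  in distinct charts and one of them is outside the overlap.\<close>

lemma Hausdorff_glued: "Hausdorff_space glued"
  unfolding Hausdorff_space_def
proof (intro allI impI, elim conjE)
  fix c d assume cd: "c \<in> topspace glued" "d \<in> topspace glued" "c \<noteq> d"
  obtain j p where c: "j \<in> I" "p \<in> S" "c = pt j p"
    using cd(1) Union_patch unfolding patch_def by blast
  obtain k q where d: "k \<in> I" "q \<in> S" "d = pt k q"
    using cd(2) Union_patch unfolding patch_def by blast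
  consider "j = k" | "p \<in> W" "q \<in> W" | "j \<noteq> k" "p \<notin> W" | "j \<noteq> k" "q \<notin> W" by blast
  then show "\<exists>\<U> \<V>. openin glued \<U> \<and> openin glued \<V> \<and> c \<in> \<U> \<and> d \<in> \<V> \<and> disjnt \<U> \<V>"
  proof cases
    case 1
    then show ?thesis using separated_pt_same_chart c d cd(3) by blast
  next
    case 2
    then have "d = pt j (\<Phi> j (\<Psi> k q))" "\<Phi> j (\<Psi> k q) \<in> S"
      using c(1) d pt_transition W_S \<Phi>_W \<Psi>_W by auto
    then show ?thesis using separated_pt_same_chart c cd(3) by blast
  next
    case 3
    then show ?thesis using separated_pt c d by simp
  next
    case 4
    then obtain \<V> \<U> where "openin glued \<V>" "openin glued \<U>" "d \<in> \<V>" "c \<in> \<U>" "disjnt \<V> \<U>"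
      using separated_pt[OF d(1) c(1), of q p] c d by auto
    then show ?thesis
      by (intro exI[of _ \<U>] exI[of _ \<V>]) (simp add: disjnt_sym)
  qed
qed

lemma complex_manifold_glued: "complex_manifold glued I patch chart"
  unfolding complex_manifold_def
  by (simp add: Hausdorff_glued second_countable_glued complex_atlas_glued)

text \<open>It suffices to compare every local representative with one field \<open>F\<close> in reference coordinates:
  the differential of \<open>\<Phi> k \<circ> \<Psi> j\<close> sends \<open>V j\<close> first back to \<open>F\<close>, because the differentials of \<open>\<Psi> j\<close> and
  \<open>\<Phi> j\<close> are inverse to each other, and then to \<open>V k\<close>.\<close>

lemma holomorphic_vector_fieldI:
  assumes hol: "\<And>j. j \<in> I \<Longrightarrow> holomorphic_map_on (V j) S"
    and push: "\<And>j r. j \<in> I \<Longrightarrow> r \<in> W \<Longrightarrow> V j (\<Phi> j r) = frechet_derivative (\<Phi> j) (at r) (F r)"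
  shows "holomorphic_vector_field I patch chart V"
  unfolding holomorphic_vector_field_def
proof (intro conjI ballI)
  fix j assume "j \<in> I"
  then show "holomorphic_map_on (V j) (chart j ` patch j)" by (simp add: chart_patch hol)
next
  fix j k p assume jk: "j \<in> I" "k \<in> I" and p: "p \<in> chart j ` (patch j \<inter> patch k)"
  let ?T = "transition patch chart j k"
  show "V k (?T p) = frechet_derivative ?T (at p) (V j p)"
  proof (cases "j = k")
    case True
    then have "p \<in> S" using p jk by (simp add: chart_patch)
    have "(?T has_derivative (\<lambda>v. v)) (at p)"
      by (rule has_derivative_transform_within_open[OF has_derivative_ident open_S \<open>p \<in> S\<close>])
         (use True jk transition_same in auto)
    then have "frechet_derivative ?T (at p) = (\<lambda>v. v)" by (rule frechet_derivative_at[symmetric])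
    then show ?thesis using True jk \<open>p \<in> S\<close> by (simp add: transition_same)
  next
    case False
    then have p: "p \<in> W" using p jk by (simp add: chart_overlap)
    define r where "r = \<Psi> j p"
    have r: "r \<in> W" "\<Phi> j r = p" using p jk by (auto simp: r_def \<Psi>_W \<Phi>_\<Psi>)
    have W: "open W" using \<Phi>_hol jk(1) holomorphic_map_on_open by blast
    have D\<Phi>: "(\<Phi> i has_derivative frechet_derivative (\<Phi> i) (at r)) (at r)" if "i \<in> I" for i
      using holomorphic_map_on_differentiable[OF \<Phi>_hol[OF that] r(1)]
      by (simp add: frechet_derivative_works)
    have D\<Psi>: "(\<Psi> j has_derivative frechet_derivative (\<Psi> j) (at p)) (at p)"
      using holomorphic_map_on_differentiable[OF \<Psi>_hol[OF jk(1)] p]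
      by (simp add: frechet_derivative_works)
    have "(\<Psi> j \<circ> \<Phi> j has_derivative
        frechet_derivative (\<Psi> j) (at p) \<circ> frechet_derivative (\<Phi> j) (at r)) (at r)"
      using diff_chain_at[OF D\<Phi>[OF jk(1)]] D\<Psi> r(2) by simp
    moreover have "(\<Psi> j \<circ> \<Phi> j has_derivative (\<lambda>v. v)) (at r)"
      by (rule has_derivative_transform_within_open[OF has_derivative_ident W r(1)])
         (use jk \<Psi>_\<Phi> in auto)
    ultimately have inv: "frechet_derivative (\<Psi> j) (at p) \<circ> frechet_derivative (\<Phi> j) (at r) = (\<lambda>v. v)"
      by (rule has_derivative_unique)
    have "(\<Phi> k \<circ> \<Psi> j has_derivative
        frechet_derivative (\<Phi> k) (at r) \<circ> frechet_derivative (\<Psi> j) (at p)) (at p)"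
      using diff_chain_at[OF D\<Psi>] D\<Phi>[OF jk(2)] by (simp add: r_def)
    then have "(?T has_derivative
        frechet_derivative (\<Phi> k) (at r) \<circ> frechet_derivative (\<Psi> j) (at p)) (at p)"
      by (rule has_derivative_transform_within_open[OF _ W p]) (use jk transition_eq in auto)
    then have "frechet_derivative ?T (at p) (V j p)
        = frechet_derivative (\<Phi> k) (at r) (frechet_derivative (\<Psi> j) (at p) (V j p))"
      by (metis frechet_derivative_at comp_apply)
    also have Vj: "V j p = frechet_derivative (\<Phi> j) (at r) (F r)"
      using push[OF jk(1) r(1)] r(2) by simp
    also have "frechet_derivative (\<Psi> j) (at p) \<dots> = F r" using fun_cong[OF inv] by simp
    also have "frechet_derivative (\<Phi> k) (at r) (F r) = V k (\<Phi> k r)" using push[OF jk(2) r(1)] by simp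
    also have "\<Phi> k r = ?T p" using jk p by (simp add: transition_eq r_def)
    finally show ?thesis unfolding Vj by (rule sym)
  qed
qed

end

section \<open>Polynomials in three functions\<close>

text \<open>Polynomials with constant coefficients on a fibre and polynomials whose coefficients depend on
  time are treated together: the coefficients form a ring \<open>C\<close> of functions that contains the constants.\<close>

locale coefficient_ring =
  fixes C :: "('a \<Rightarrow> complex) set"
  assumes const: "(\<lambda>_. k) \<in> C"
    and add: "c \<in> C \<Longrightarrow> c' \<in> C \<Longrightarrow> (\<lambda>p. c p + c' p) \<in> C"
    and mult: "c \<in> C \<Longrightarrow> c' \<in> C \<Longrightarrow> (\<lambda>p. c p * c' p) \<in> C"

text \<open>Sums of monomials in three fixed functions. An inductive predicate gives closure under products
  by two inductions, without convolving coefficient arrays.\<close>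

inductive poly_in :: "('a \<Rightarrow> complex) set \<Rightarrow> ('a \<Rightarrow> complex) \<Rightarrow> ('a \<Rightarrow> complex) \<Rightarrow> ('a \<Rightarrow> complex)
    \<Rightarrow> ('a \<Rightarrow> complex) \<Rightarrow> bool"
  for C :: "('a \<Rightarrow> complex) set" and x y z :: "'a \<Rightarrow> complex" where
  poly_in_zero: "poly_in C x y z (\<lambda>_. 0)"
| poly_in_add_monomial: "c \<in> C \<Longrightarrow> poly_in C x y z f \<Longrightarrow>
    poly_in C x y z (\<lambda>p. c p * x p ^ a * y p ^ b * z p ^ d + f p)"

context coefficient_ring
begin

lemma poly_in_monomial: "c \<in> C \<Longrightarrow> poly_in C x y z (\<lambda>p. c p * x p ^ a * y p ^ b * z p ^ d)"
  using poly_in_add_monomial[OF _ poly_in_zero, where c = c and a = a and b = b and d = d] by simp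

lemma poly_in_coefficient: "c \<in> C \<Longrightarrow> poly_in C x y z c"
  using poly_in_monomial[where a = 0 and b = 0 and d = 0] by simp

lemma poly_in_vars:
  "poly_in C x y z x" "poly_in C x y z y" "poly_in C x y z z"
  using poly_in_monomial[OF const[of 1], where a = 1 and b = 0 and d = 0]
    poly_in_monomial[OF const[of 1], where a = 0 and b = 1 and d = 0]
    poly_in_monomial[OF const[of 1], where a = 0 and b = 0 and d = 1] by simp_all

lemma poly_in_add:
  assumes "poly_in C x y z f" and g: "poly_in C x y z g"
  shows "poly_in C x y z (\<lambda>p. f p + g p)"
  using assms(1)
proof induction
  case poly_in_zero
  then show ?case using g by simp
next
  case (poly_in_add_monomial c f a b d)
  show ?case
    using poly_in.poly_in_add_monomial[OF poly_in_add_monomial(1,3)] by (simp add: add.assoc)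
qed

lemma poly_in_mult:
  assumes "poly_in C x y z f" and g: "poly_in C x y z g"
  shows "poly_in C x y z (\<lambda>p. f p * g p)"
  using assms(1)
proof induction
  case poly_in_zero
  then show ?case using poly_in.poly_in_zero by simp
next
  case (poly_in_add_monomial c f a b d)
  have "poly_in C x y z (\<lambda>p. c p * x p ^ a * y p ^ b * z p ^ d * g p)"
    using g
  proof induction
    case poly_in_zero
    then show ?case using poly_in.poly_in_zero by simp
  next
    case (poly_in_add_monomial c' g a' b' d')
    show ?case
      using poly_in.poly_in_add_monomial[OF mult[OF \<open>c \<in> C\<close> poly_in_add_monomial(1)] poly_in_add_monomial(3),
        where a = "a + a'" and b = "b + b'" and d = "d + d'"]
      by (simp add: power_add algebra_simps)
  qed
  then show ?case using poly_in_add[OF _ poly_in_add_monomial(3)] by (simp add: distrib_right)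
qed

lemma poly_in_minus: "poly_in C x y z f \<Longrightarrow> poly_in C x y z (\<lambda>p. - f p)"
  using poly_in_mult[OF poly_in_coefficient[OF const[of "-1"]]] by simp

lemma poly_in_diff: "poly_in C x y z f \<Longrightarrow> poly_in C x y z g \<Longrightarrow> poly_in C x y z (\<lambda>p. f p - g p)"
  using poly_in_add[OF _ poly_in_minus] by simp

lemma poly_in_power: "poly_in C x y z f \<Longrightarrow> poly_in C x y z (\<lambda>p. f p ^ n)"
  by (induction n) (use poly_in_coefficient[OF const[of 1]] poly_in_mult[of x y z f] in simp_all)

text \<open>This is the shape in which \<open>polynomial3\<close> and \<open>polynomial_over_time\<close> are defined; padding with
  zero coefficients brings all monomials to a common degree bound.\<close>

lemma poly_in_expand:
  assumes "poly_in C x y z f"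
  shows "\<exists>N c. (\<forall>a b d. c a b d \<in> C) \<and>
    (\<forall>p. f p = (\<Sum>a\<le>N. \<Sum>b\<le>N. \<Sum>d\<le>(N::nat). c a b d p * x p ^ a * y p ^ b * z p ^ d))"
  using assms
proof induction
  case poly_in_zero
  show ?case by (intro exI[of _ 0] exI[of _ "\<lambda>_ _ _ _. 0"]) (simp add: const)
next
  case (poly_in_add_monomial c0 f a0 b0 d0)
  then obtain N c where c: "\<And>a b d. c a b d \<in> C"
    and f: "\<And>p. f p = (\<Sum>a\<le>N. \<Sum>b\<le>N. \<Sum>d\<le>N. c a b d p * x p ^ a * y p ^ b * z p ^ d)" by blast
  define N' where "N' = Max {N, a0, b0, d0}"
  have N': "N \<le> N'" "a0 \<le> N'" "b0 \<le> N'" "d0 \<le> N'" by (simp_all add: N'_def)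
  \<comment> \<open>The coefficients of \<open>f\<close> and of the new monomial, both extended by zero to the larger bound.\<close>
  define old where "old = (\<lambda>a b d. if a \<le> N \<and> b \<le> N \<and> d \<le> N then c a b d else (\<lambda>_. 0))"
  define new where "new = (\<lambda>a b d. if a = a0 \<and> b = b0 \<and> d = d0 then c0 else (\<lambda>_. 0))"
  let ?S = "\<lambda>n g. \<Sum>(a, b, d)\<in>{..n} \<times> {..n} \<times> {..n::nat}. g a b d"
  have "?S N (\<lambda>a b d. c a b d p * x p ^ a * y p ^ b * z p ^ d)
      = ?S N' (\<lambda>a b d. old a b d p * x p ^ a * y p ^ b * z p ^ d)" for p
    using N'(1) by (intro sum.mono_neutral_cong_left) (auto simp: old_def split: if_splits)
  moreover have "c0 p * x p ^ a0 * y p ^ b0 * z p ^ d0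
      = ?S N' (\<lambda>a b d. new a b d p * x p ^ a * y p ^ b * z p ^ d)" for p
  proof -
    have "?S N' (\<lambda>a b d. new a b d p * x p ^ a * y p ^ b * z p ^ d)
        = (\<Sum>(a, b, d)\<in>{(a0, b0, d0)}. new a b d p * x p ^ a * y p ^ b * z p ^ d)"
      using N' by (intro sum.mono_neutral_right) (auto simp: new_def split: if_splits)
    then show ?thesis by (simp add: new_def)
  qed
  ultimately have "c0 p * x p ^ a0 * y p ^ b0 * z p ^ d0 + f p =
      ?S N' (\<lambda>a b d. (new a b d p + old a b d p) * x p ^ a * y p ^ b * z p ^ d)" for p
    unfolding f by (simp add: sum.cartesian_product case_prod_unfold distrib_right sum.distrib)
  moreover have "(\<lambda>p. new a b d p + old a b d p) \<in> C" for a b d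
  proof -
    have "new a b d \<in> C" "old a b d \<in> C"
      using poly_in_add_monomial(1) c const[of 0] by (auto simp: new_def old_def)
    then show ?thesis by (rule add)
  qed
  ultimately show ?case
    by (intro exI[of _ N'] exI[of _ "\<lambda>a b d p. new a b d p + old a b d p"])
       (simp add: sum.cartesian_product case_prod_unfold)
qed

end

section \<open>Regular functions off the plane z = 0\<close>

interpretation const: coefficient_ring "range (\<lambda>k (_ :: complex^3). k)"
  by unfold_locales (auto simp: fun_eq_iff)

abbreviation poly_fibre :: "(complex^3 \<Rightarrow> complex) \<Rightarrow> bool" where
  "poly_fibre \<equiv> poly_in (range (\<lambda>k _. k)) (\<lambda>v. v$1) (\<lambda>v. v$2) (\<lambda>v. v$3)"

lemma poly_fibre_imp_polynomial3:
  assumes "poly_fibre f" shows "polynomial3 f"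
proof -
  obtain N c where c: "\<And>a b d. c a b d \<in> range (\<lambda>k _. k)"
    and f: "\<And>p. f p = (\<Sum>a\<le>N. \<Sum>b\<le>N. \<Sum>d\<le>(N::nat). c a b d p * p$1 ^ a * p$2 ^ b * p$3 ^ d)"
    using const.poly_in_expand[OF assms] by blast
  have "\<exists>k. c a b d = (\<lambda>_. k)" for a b d using c[of a b d] by auto
  then obtain k where "\<And>a b d. c a b d = (\<lambda>_. k a b d)" by metis
  then show ?thesis unfolding polynomial3_def f by auto
qed

text \<open>This differs from \<open>regular_off_z\<close> in that the numerator is a \<open>poly_in\<close>, for which products are
  available.\<close>

definition regular :: "(complex^3 \<Rightarrow> complex) \<Rightarrow> bool" where
  "regular f \<longleftrightarrow> (\<exists>g n. poly_fibre g \<and> (\<forall>v. v$3 \<noteq> 0 \<longrightarrow> f v = g v / v$3 ^ n))"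

lemma regular_imp_regular_off_z: "regular f \<Longrightarrow> regular_off_z f"
  unfolding regular_def regular_off_z_def using poly_fibre_imp_polynomial3 by blast

named_theorems regular_intros

lemma regular_poly: "poly_fibre f \<Longrightarrow> regular f"
  unfolding regular_def by (intro exI[of _ f] exI[of _ 0]) simp

lemma regular_const [regular_intros]: "regular (\<lambda>_. k)"
  by (intro regular_poly const.poly_in_coefficient) simp

lemma regular_vars [regular_intros]:
  "regular (\<lambda>v. v$1)" "regular (\<lambda>v. v$2)" "regular (\<lambda>v. v$3)"
  by (intro regular_poly const.poly_in_vars)+

lemma regular_recip [regular_intros]: "regular (\<lambda>v. 1 / v$3)"
  unfolding regular_def
  by (intro exI[of _ "\<lambda>_. 1"] exI[of _ 1]) (simp add: const.poly_in_coefficient)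

lemma regular_mult [regular_intros]:
  assumes "regular f" "regular g" shows "regular (\<lambda>v. f v * g v)"
proof -
  obtain F m G n where F: "poly_fibre F" "\<And>v. v$3 \<noteq> 0 \<Longrightarrow> f v = F v / v$3 ^ m"
    and G: "poly_fibre G" "\<And>v. v$3 \<noteq> 0 \<Longrightarrow> g v = G v / v$3 ^ n"
    using assms unfolding regular_def by metis
  show ?thesis unfolding regular_def
    by (intro exI[of _ "\<lambda>v. F v * G v"] exI[of _ "m + n"])
      (simp add: const.poly_in_mult F G power_add)
qed

lemma regular_add [regular_intros]:
  assumes "regular f" "regular g" shows "regular (\<lambda>v. f v + g v)"
proof -
  obtain F m G n where F: "poly_fibre F" "\<And>v. v$3 \<noteq> 0 \<Longrightarrow> f v = F v / v$3 ^ m"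
    and G: "poly_fibre G" "\<And>v. v$3 \<noteq> 0 \<Longrightarrow> g v = G v / v$3 ^ n"
    using assms unfolding regular_def by metis
  have "poly_fibre (\<lambda>v. F v * v$3 ^ n + G v * v$3 ^ m)"
    by (intro const.poly_in_add const.poly_in_mult const.poly_in_power const.poly_in_vars F(1) G(1))
  then show ?thesis unfolding regular_def
    by (intro exI[of _ "\<lambda>v. F v * v$3 ^ n + G v * v$3 ^ m"] exI[of _ "m + n"])
      (simp add: F G power_add field_simps)
qed

lemma regular_minus [regular_intros]: "regular f \<Longrightarrow> regular (\<lambda>v. - f v)"
  using regular_mult[OF regular_const[of "-1"]] by simp

lemma regular_diff [regular_intros]: "regular f \<Longrightarrow> regular g \<Longrightarrow> regular (\<lambda>v. f v - g v)"
  using regular_add[OF _ regular_minus] by simp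

lemma regular_power [regular_intros]: "regular f \<Longrightarrow> regular (\<lambda>v. f v ^ n)"
  by (induction n) (use regular_const regular_mult[of f] in simp_all)

section \<open>Polynomials with coefficients rational in time\<close>

lemma rational_holomorphic_const: "rational_holomorphic (\<lambda>_. k)"
  unfolding rational_holomorphic_def
  by (intro conjI exI[of _ "[:k:]"] exI[of _ 1]) auto

lemma rational_holomorphic_recip: "rational_holomorphic (\<lambda>t. 1 / t)"
  unfolding rational_holomorphic_def
  by (intro conjI exI[of _ 1] exI[of _ "[:0, 1:]"] holomorphic_intros) auto

lemma rational_holomorphic_add:
  assumes "rational_holomorphic f" "rational_holomorphic g"
  shows "rational_holomorphic (\<lambda>t. f t + g t)"
proof -
  obtain p q r s where "q \<noteq> 0" "\<forall>t. t \<noteq> 0 \<and> poly q t \<noteq> 0 \<longrightarrow> f t = poly p t / poly q t"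
    and "s \<noteq> 0" "\<forall>t. t \<noteq> 0 \<and> poly s t \<noteq> 0 \<longrightarrow> g t = poly r t / poly s t"
    using assms unfolding rational_holomorphic_def by metis
  then have "q * s \<noteq> 0 \<and> (\<forall>t. t \<noteq> 0 \<and> poly (q * s) t \<noteq> 0 \<longrightarrow>
      f t + g t = poly (p * s + r * q) t / poly (q * s) t)"
    by (simp add: add_frac_eq)
  moreover have "(\<lambda>t. f t + g t) holomorphic_on - {0}"
    using assms unfolding rational_holomorphic_def by (intro holomorphic_intros) auto
  ultimately show ?thesis
    unfolding rational_holomorphic_def by (intro conjI exI[of _ "p * s + r * q"] exI[of _ "q * s"]) simp_all
qed

lemma rational_holomorphic_mult:
  assumes "rational_holomorphic f" "rational_holomorphic g"
  shows "rational_holomorphic (\<lambda>t. f t * g t)"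
proof -
  obtain p q r s where "q \<noteq> 0" "\<forall>t. t \<noteq> 0 \<and> poly q t \<noteq> 0 \<longrightarrow> f t = poly p t / poly q t"
    and "s \<noteq> 0" "\<forall>t. t \<noteq> 0 \<and> poly s t \<noteq> 0 \<longrightarrow> g t = poly r t / poly s t"
    using assms unfolding rational_holomorphic_def by metis
  then have "q * s \<noteq> 0 \<and> (\<forall>t. t \<noteq> 0 \<and> poly (q * s) t \<noteq> 0 \<longrightarrow>
      f t * g t = poly (p * r) t / poly (q * s) t)"
    by simp
  moreover have "(\<lambda>t. f t * g t) holomorphic_on - {0}"
    using assms unfolding rational_holomorphic_def by (intro holomorphic_intros) auto
  ultimately show ?thesis
    unfolding rational_holomorphic_def by (intro conjI exI[of _ "p * r"] exI[of _ "q * s"]) simp_all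
qed

definition time_coefficients :: "(complex^4 \<Rightarrow> complex) set" where
  "time_coefficients = {\<lambda>p. c (p$4) | c. rational_holomorphic c}"

interpretation time: coefficient_ring time_coefficients
proof
  show "(\<lambda>_. k) \<in> time_coefficients" for k
    using rational_holomorphic_const[of k] unfolding time_coefficients_def by fast
  show "(\<lambda>p. c p + c' p) \<in> time_coefficients"
    if "c \<in> time_coefficients" "c' \<in> time_coefficients" for c c'
    using that rational_holomorphic_add unfolding time_coefficients_def by fast
  show "(\<lambda>p. c p * c' p) \<in> time_coefficients"
    if "c \<in> time_coefficients" "c' \<in> time_coefficients" for c c'
    using that rational_holomorphic_mult unfolding time_coefficients_def by fast
qed

lemma recip_time: "(\<lambda>p. 1 / p$4) \<in> time_coefficients"
  using rational_holomorphic_recip unfolding time_coefficients_def by fast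

abbreviation poly_time :: "(complex^4 \<Rightarrow> complex) \<Rightarrow> bool" where
  "poly_time \<equiv> poly_in time_coefficients (\<lambda>p. p$1) (\<lambda>p. p$2) (\<lambda>p. p$3)"

lemma poly_time_imp_polynomial_over_time:
  assumes "poly_time f" shows "polynomial_over_time f"
proof -
  obtain N c where c: "\<And>a b d. c a b d \<in> time_coefficients"
    and f: "\<And>p. f p = (\<Sum>a\<le>N. \<Sum>b\<le>N. \<Sum>d\<le>(N::nat). c a b d p * p$1 ^ a * p$2 ^ b * p$3 ^ d)"
    using time.poly_in_expand[OF assms] by blast
  have "\<exists>k. rational_holomorphic k \<and> c a b d = (\<lambda>p. k (p$4))" for a b d
    using c[of a b d] unfolding time_coefficients_def by auto
  then obtain k where "\<And>a b d. rational_holomorphic (k a b d)"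
      "\<And>a b d. c a b d = (\<lambda>p. k a b d (p$4))" by metis
  then show ?thesis unfolding polynomial_over_time_def f by auto
qed

lemmas poly_time_intros = time.poly_in_coefficient[OF time.const]
  time.poly_in_coefficient[OF recip_time] time.poly_in_vars time.poly_in_add time.poly_in_diff
  time.poly_in_minus time.poly_in_mult time.poly_in_power

section \<open>The coordinate changes and their inverses\<close>

lemma vector_4 [simp]:
  "(vector [a, b, c, d] :: 'a::zero^4) $ 1 = a" "(vector [a, b, c, d] :: 'a::zero^4) $ 2 = b"
  "(vector [a, b, c, d] :: 'a::zero^4) $ 3 = c" "(vector [a, b, c, d] :: 'a::zero^4) $ 4 = d"
  by (simp_all add: vector_def)

text \<open>With \<open>1 / t\<close> as the only fraction in \<open>t\<close>, differentiation stays within polynomials in \<open>1 / t\<close>.\<close>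

lemma change1_eq:
  "change1 \<alpha>0 \<alpha>1 t v = vector [v$1,
     - (v$2 * v$3 + (2 * (2*\<alpha>1 - 1) * v$1 + 2*\<alpha>0) * (1 / t)^2) * v$3, 1 / v$3]"
  by (simp add: change1_def Let_def power_one_over)

text \<open>The bracket has the shape \<open>E z - B + D\<close> with \<open>E = y + \<dots>\<close>, where \<open>B\<close> and the rest of \<open>E\<close> are affine
  in \<open>x\<close> and \<open>D\<close> depends on \<open>z\<close> only. Unlike in \<open>change1\<close>, the case \<open>t = 0\<close> must be excluded, since
  \<open>(t z + 4) / (4 t)\<close> contains the term \<open>z / 4\<close> only for \<open>t \<noteq> 0\<close>.\<close>

lemma change2_eq:
  assumes "t \<noteq> 0"
  shows "change2 \<alpha>0 \<alpha>1 t v = vector [v$1 + 1/2 * v$3,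
     - ((v$2 + 2 * (1 / t) * v$1 - 1 / t - (\<alpha>1^2 - \<alpha>1 - 7/4) * (1 / t)^2) * v$3
        - ((2 * (2*\<alpha>1 - 3) * v$1 + 2 * (\<alpha>0 + 1)) * (1 / t)^2
            + (2*\<alpha>1 - 1) * (2*\<alpha>1 - 3) * (1 / t)^3)
        + (1/4 * v$3 + 1 / t) * v$3^2) * v$3, 1 / v$3]"
proof -
  have "2 / t * x = 2 * (1/t) * x"
    "(4 * (\<alpha>1 - 1) * \<alpha>1 - 7) / (4 * t^2) = (\<alpha>1^2 - \<alpha>1 - 7/4) * (1/t)^2"
    "(2 * (2*\<alpha>1 - 3) * t * x + 2 * (\<alpha>0 + 1) * t + 4 * \<alpha>1^2 - 8*\<alpha>1 + 3) / t^3
      = (2 * (2*\<alpha>1 - 3) * x + 2 * (\<alpha>0 + 1)) * (1/t)^2 + (2*\<alpha>1 - 1) * (2*\<alpha>1 - 3) * (1/t)^3"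
    "(t * z + 4) / (4 * t) = 1/4 * z + 1/t" for x z :: complex
    using assms by (simp_all add: divide_simps) (simp_all add: algebra_simps eval_nat_numeral)
  then show ?thesis unfolding change2_def Let_def by simp
qed

text \<open>Recover \<open>z\<close>, then \<open>x\<close>, and then solve \<open>- (E z - B + D) z = Y\<close> for \<open>y\<close>, a summand of \<open>E\<close>.\<close>

definition change2_inverse :: "complex \<Rightarrow> complex \<Rightarrow> complex \<Rightarrow> complex^3 \<Rightarrow> complex^3" where
  "change2_inverse \<alpha>0 \<alpha>1 t v = (let z = 1 / v$3; x = v$1 - 1/2 * z in vector [x,
     ((2 * (2*\<alpha>1 - 3) * x + 2 * (\<alpha>0 + 1)) * (1/t)^2 + (2*\<alpha>1 - 1) * (2*\<alpha>1 - 3) * (1/t)^3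
        - (1/4 * z + 1/t) * z^2 - v$2 * v$3) * v$3
      - (2 * (1/t) * x - 1/t - (\<alpha>1^2 - \<alpha>1 - 7/4) * (1/t)^2),
     z])"

text \<open>\<open>change1\<close> is its own inverse: \<open>x\<close> is fixed, \<open>z\<close> is inverted, and the equation
  \<open>Y = - (y z + L) z\<close> is equivalent to \<open>y = - (Y w + L) w\<close>.\<close>

definition change_inverse :: "complex \<Rightarrow> complex \<Rightarrow> nat \<Rightarrow> complex \<Rightarrow> complex^3 \<Rightarrow> complex^3" where
  "change_inverse \<alpha>0 \<alpha>1 j t v =
     (if j = 0 then v else if j = 1 then change1 \<alpha>0 \<alpha>1 t v else change2_inverse \<alpha>0 \<alpha>1 t v)"

lemma change1_involution:
  "v$3 \<noteq> 0 \<Longrightarrow> t \<noteq> 0 \<Longrightarrow> change1 \<alpha>0 \<alpha>1 t (change1 \<alpha>0 \<alpha>1 t v) = v"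
  by (simp add: change1_eq vec_eq_iff forall_3 field_simps)

lemma change2_inverse_change2:
  assumes "v$3 \<noteq> 0" "t \<noteq> 0"
  shows "change2_inverse \<alpha>0 \<alpha>1 t (change2 \<alpha>0 \<alpha>1 t v) = v"
proof -
  have *: "(B - D - - ((y + a - b - c) * z - B + D) * z * (1 / z)) * (1 / z) - (a - b - c) = y"
    if "z \<noteq> 0" for B D a b c y z :: complex
    using that by (simp add: field_simps)
  have x: "v$1 + 1/2 * v$3 - 1/2 * (v$3) = v$1" and z: "1 / (1 / v$3) = v$3" by simp_all
  show ?thesis
    unfolding change2_inverse_def change2_eq[OF assms(2)] Let_def vector_3 z x *[OF assms(1)]
    by (simp add: vec_eq_iff forall_3)
qed

lemma change2_change2_inverse:
  assumes "v$3 \<noteq> 0" "t \<noteq> 0"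
  shows "change2 \<alpha>0 \<alpha>1 t (change2_inverse \<alpha>0 \<alpha>1 t v) = v"
proof -
  have *: "- (((B - D - Y * w) * w - (a - b - c) + a - b - c) * (1 / w) - B + D) * (1 / w) = Y"
    if "w \<noteq> 0" for B D a b c w Y :: complex
    using that by (simp add: field_simps)
  show ?thesis
    unfolding change2_inverse_def change2_eq[OF assms(2)] Let_def vector_3 *[OF assms(1)]
    by (simp add: vec_eq_iff forall_3)
qed

lemma change_inverse_change:
  assumes "v$3 \<noteq> 0" "t \<noteq> 0"
  shows "change_inverse \<alpha>0 \<alpha>1 j t (change \<alpha>0 \<alpha>1 j t v) = v"
  using assms
  by (simp add: change_def change_inverse_def change1_involution change2_inverse_change2)

lemma change_change_inverse:
  assumes "v$3 \<noteq> 0" "t \<noteq> 0"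
  shows "change \<alpha>0 \<alpha>1 j t (change_inverse \<alpha>0 \<alpha>1 j t v) = v"
  using assms
  by (simp add: change_def change_inverse_def change1_involution change2_change2_inverse)

lemma change_nonzero: "v$3 \<noteq> 0 \<Longrightarrow> t \<noteq> 0 \<Longrightarrow> change \<alpha>0 \<alpha>1 j t v $ 3 \<noteq> 0"
  by (simp add: change_def change1_eq change2_eq)

lemma change_inverse_nonzero: "v$3 \<noteq> 0 \<Longrightarrow> change_inverse \<alpha>0 \<alpha>1 j t v $ 3 \<noteq> 0"
  by (simp add: change_inverse_def change1_eq change2_inverse_def Let_def)

lemma regular_change1: "regular (\<lambda>v. change1 \<alpha>0 \<alpha>1 t v $ k)"
  by (insert exhaust_3[of k], elim disjE; simp only: change1_eq vector_3; intro regular_intros)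

lemma regular_change2: "t \<noteq> 0 \<Longrightarrow> regular (\<lambda>v. change2 \<alpha>0 \<alpha>1 t v $ k)"
  unfolding change2_eq
  by (insert exhaust_3[of k], elim disjE; simp only: vector_3; intro regular_intros)

lemma regular_change2_inverse: "regular (\<lambda>v. change2_inverse \<alpha>0 \<alpha>1 t v $ k)"
  by (insert exhaust_3[of k], elim disjE; simp only: change2_inverse_def Let_def vector_3; intro regular_intros)

text \<open>The inverse chosen by \<open>inv_into\<close> agrees with any explicit regular inverse \<open>g\<close> on \<open>z \<noteq> 0\<close>, which is
  the only place where regularity is tested.\<close>

lemma isomorphism_off_zI:
  assumes "\<And>v. v$3 \<noteq> 0 \<Longrightarrow> f v $ 3 \<noteq> 0" "\<And>v. v$3 \<noteq> 0 \<Longrightarrow> g v $ 3 \<noteq> 0"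
    "\<And>v. v$3 \<noteq> 0 \<Longrightarrow> g (f v) = v" "\<And>v. v$3 \<noteq> 0 \<Longrightarrow> f (g v) = v"
    "\<And>k. regular (\<lambda>v. f v $ k)" "\<And>k. regular (\<lambda>v. g v $ k)"
  shows "isomorphism_off_z f"
proof -
  let ?Z = "{v :: complex^3. v$3 \<noteq> 0}"
  have bij: "bij_betw f ?Z ?Z"
    by (rule bij_betw_byWitness[where f' = g]) (use assms(1-4) in auto)
  have "inv_into ?Z f v = g v" if "v$3 \<noteq> 0" for v
    using that assms(2,4) bij by (intro inv_into_f_eq) (auto simp: bij_betw_def)
  then have "regular (\<lambda>v. inv_into ?Z f v $ k)" for k
    using assms(6)[of k] unfolding regular_def by simp
  then show ?thesis
    unfolding isomorphism_off_z_def using bij assms(5) regular_imp_regular_off_z by blast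
qed

lemma isomorphism_off_z_change:
  assumes "t \<noteq> 0" "i \<in> {1, 2}"
  shows "isomorphism_off_z (change \<alpha>0 \<alpha>1 i t)"
proof (rule isomorphism_off_zI[where g = "change_inverse \<alpha>0 \<alpha>1 i t"])
  show "regular (\<lambda>v. change \<alpha>0 \<alpha>1 i t v $ k)" for k
    using assms by (auto simp: change_def regular_change1 regular_change2)
  show "regular (\<lambda>v. change_inverse \<alpha>0 \<alpha>1 i t v $ k)" for k
    using assms by (auto simp: change_inverse_def regular_change1 regular_change2_inverse)
qed (use assms in \<open>simp_all add: change_nonzero change_inverse_nonzero change_inverse_change
  change_change_inverse\<close>)

section \<open>The volume form of a fibre\<close>

text \<open>The differentials of both coordinate changes are of this triangular form up to the order of the
  variables, with determinant \<open>b * f\<close>.\<close>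

lemma wedge3_unipotent:
  assumes "\<And>u. \<beta> u = u$1 + c * u$3" "\<And>u. \<gamma> u = a * u$1 + b * u$2 + e * u$3" "\<And>u. \<delta> u = f * u$3"
    and "b * f = 1"
  shows "wedge3 \<beta> \<gamma> \<delta> = wedge3 (\<lambda>u. u$1) (\<lambda>u. u$2) (\<lambda>u. u$3)"
proof (intro ext)
  fix u v w
  have "wedge3 \<beta> \<gamma> \<delta> u v w = (b * f) * wedge3 (\<lambda>u. u$1) (\<lambda>u. u$2) (\<lambda>u. u$3) u v w"
    unfolding wedge3_def assms(1-3) by (simp add: algebra_simps)
  then show "wedge3 \<beta> \<gamma> \<delta> u v w = wedge3 (\<lambda>u. u$1) (\<lambda>u. u$2) (\<lambda>u. u$3) u v w"
    using assms(4) by simp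
qed

lemma volume_form_id: "volume_form (\<lambda>v. v) p = wedge3 (\<lambda>u. u$1) (\<lambda>u. u$2) (\<lambda>u. u$3)"
  unfolding volume_form_def differential_def
  by (simp add: dir_deriv_frechet_derivative[OF dir_deriv_nth, abs_def])

lemma volume_form_eq:
  assumes "\<And>u. dir_deriv (\<lambda>v. f v $ 1) p u (u$1 + c * u$3)"
    "\<And>u. dir_deriv (\<lambda>v. f v $ 2) p u (a * u$1 + b * u$2 + e * u$3)"
    "\<And>u. dir_deriv (\<lambda>v. f v $ 3) p u (d * u$3)" "b * d = 1"
  shows "volume_form f p = volume_form (\<lambda>v. v) p"
  unfolding volume_form_id unfolding volume_form_def differential_def
  by (rule wedge3_unipotent[where a = a and b = b and c = c and e = e and f = d])
     (simp_all add: assms dir_deriv_frechet_derivative[OF assms(1)] dir_deriv_frechet_derivative[OF assms(2)]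
       dir_deriv_frechet_derivative[OF assms(3)])

text \<open>The numbers \<open>a\<close>, \<open>b\<close>, \<open>e\<close> are the partial derivatives of the second coordinate.\<close>

lemma volume_form_change1:
  assumes "p$3 \<noteq> 0"
  shows "volume_form (change1 \<alpha>0 \<alpha>1 t) p = volume_form (\<lambda>v. v) p"
proof (rule volume_form_eq[where c = 0
      and a = "- 2 * (2*\<alpha>1 - 1) * (1/t)^2 * p$3" and b = "- (p$3^2)"
      and e = "- 2 * p$2 * p$3 - (2 * (2*\<alpha>1 - 1) * p$1 + 2*\<alpha>0) * (1 / t)^2"
      and d = "- ((1 / p$3)^2)"])
  show "- (p$3^2) * (- ((1 / p$3)^2)) = 1" using assms by (simp add: power_one_over)
qed (unfold change1_eq vector_3; rule dir_deriv_eq, (rule dir_deriv_intros assms)+, simp add: algebra_simps power2_eq_square)+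

lemma volume_form_change2:
  assumes "p$3 \<noteq> 0" "t \<noteq> 0"
  shows "volume_form (change2 \<alpha>0 \<alpha>1 t) p = volume_form (\<lambda>v. v) p"
proof (rule volume_form_eq[where c = "1/2"
      and a = "- (2 * (1/t) * p$3 - 2 * (2*\<alpha>1 - 3) * (1/t)^2) * p$3" and b = "- (p$3^2)"
      and e = "- (p$2 + 2 * (1 / t) * p$1 - 1 / t - (\<alpha>1^2 - \<alpha>1 - 7/4) * (1 / t)^2
           + 1/4 * (p$3)^2 + (1/4 * p$3 + 1/t) * (2 * p$3)) * p$3
         - ((p$2 + 2 * (1 / t) * p$1 - 1 / t - (\<alpha>1^2 - \<alpha>1 - 7/4) * (1 / t)^2) * p$3
        - ((2 * (2*\<alpha>1 - 3) * p$1 + 2 * (\<alpha>0 + 1)) * (1 / t)^2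
            + (2*\<alpha>1 - 1) * (2*\<alpha>1 - 3) * (1 / t)^3)
        + (1/4 * p$3 + 1 / t) * p$3^2)"
      and d = "- ((1 / p$3)^2)"])
  show "- (p$3^2) * (- ((1 / p$3)^2)) = 1" using assms by (simp add: power_one_over)
qed (unfold change2_eq[OF assms(2)] vector_3; rule dir_deriv_eq, (rule dir_deriv_intros assms)+, simp add: algebra_simps power2_eq_square)+

section \<open>The vector field in the three charts\<close>

lemma total_change_0: "total_change \<alpha>0 \<alpha>1 0 p = p"
  by (simp add: total_change_def change_def with_time_def fibre_part_def vec_eq_iff forall_4)

lemma total_change_1:
  "total_change \<alpha>0 \<alpha>1 1 p = vector [p$1,
     - (p$2 * p$3 + (2 * (2*\<alpha>1 - 1) * p$1 + 2*\<alpha>0) * (1 / p$4)^2) * p$3, 1 / p$3, p$4]"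
  by (simp add: total_change_def change_def change1_eq with_time_def fibre_part_def)

lemma total_change_2:
  assumes "p$4 \<noteq> 0"
  shows "total_change \<alpha>0 \<alpha>1 2 p = vector [p$1 + 1/2 * p$3,
     - ((p$2 + 2 * (1 / p$4) * p$1 - 1 / p$4 - (\<alpha>1^2 - \<alpha>1 - 7/4) * (1 / p$4)^2) * p$3
        - ((2 * (2*\<alpha>1 - 3) * p$1 + 2 * (\<alpha>0 + 1)) * (1 / p$4)^2
            + (2*\<alpha>1 - 1) * (2*\<alpha>1 - 3) * (1 / p$4)^3)
        + (1/4 * p$3 + 1 / p$4) * p$3^2) * p$3, 1 / p$3, p$4]"
  using assms by (simp add: total_change_def change_def change2_eq with_time_def fibre_part_def)

lemma system_field_eq:
  "system_field \<alpha>0 \<alpha>1 p = vector [p$2,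
     p$2 * p$3 + ((2*\<alpha>1 - 1) * p$1 + \<alpha>0) * (1 / p$4)^2,
     - (1/2) * p$3^2 - 4 * (1 / p$4) * p$1 - 4 * p$2 - 2 * (1 / p$4) * p$3
       + (2*\<alpha>1 - 1) * (2*\<alpha>1 - 3) / 2 * (1 / p$4)^2 + 2 * (1 / p$4), 1]"
  by (simp add: system_field_def rhs_def with_time_def fibre_part_def Let_def power_one_over add_divide_distrib add.assoc)

text \<open>The system in chart 1. Here \<open>y = - M w\<close> and \<open>K = dz/dt + z\<^sup>2/2 + 2 s z\<close>; the third component is
  \<open>- w\<^sup>2 dz/dt\<close>.\<close>

definition field1 :: "complex \<Rightarrow> complex \<Rightarrow> complex^4 \<Rightarrow> complex^4" where
  "field1 \<alpha>0 \<alpha>1 p = (let X = p$1; Y = p$2; w = p$3; s = 1 / p$4;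
     L = (2 * (2*\<alpha>1 - 1) * X + 2*\<alpha>0) * s^2;
     M = Y * w + L;
     K = (2*\<alpha>1 - 1) * (2*\<alpha>1 - 3) / 2 * s^2 + 2 * s - 4 * X * s + 4 * M * w
   in vector [- M * w,
              K * (Y * w + M) + 2 * (2*\<alpha>1 - 1) * M * s^2 - 4 * Y * s,
              1/2 + 2 * w * s - w^2 * K,
              1])"

text \<open>The system in chart 2. Here \<open>M w = - (y + z\<^sup>2/4) + P\<close> with \<open>P\<close> affine in \<open>X\<close>, and
  \<open>K = dz/dt - z\<^sup>2/2\<close>; the third component is again \<open>- w\<^sup>2 dz/dt\<close>.\<close>

definition field2 :: "complex \<Rightarrow> complex \<Rightarrow> complex^4 \<Rightarrow> complex^4" where
  "field2 \<alpha>0 \<alpha>1 p = (let X = p$1; Y = p$2; w = p$3; s = 1 / p$4;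
     L = (2 * (2*\<alpha>1 - 3) * X + 2 * (\<alpha>0 + 1)) * s^2 + (2*\<alpha>1 - 1) * (2*\<alpha>1 - 3) * s^3;
     M = Y * w - L;
     K = 4 * X * s - 2 * s - (2*\<alpha>1^2 - 8*\<alpha>1 + 7/2) * s^2 + 4 * M * w
   in vector [(2*\<alpha>1 - 1) / 2 * s^2 + M * w,
              K * (Y * w + M) + 2 * (2*\<alpha>1 - 3) * M * s^2 - 2 * Y * s,
              - 1/2 - w^2 * K,
              1])"

text \<open>The components of \<open>field1\<close> at the image of \<open>(x, y, z)\<close> are the derivatives of \<open>x\<close>,
  \<open>- (y z + L) z\<close> and \<open>1/z\<close> along the system. In the old coordinates \<open>M = - y z\<close> is divisible by \<open>z\<close>; hence
  \<open>M w\<close>, \<open>Y w\<close> and \<open>K\<close> are polynomials in \<open>x\<close>, \<open>y\<close>, \<open>z\<close>, \<open>s\<close>, and \<open>w\<close> can be eliminated with \<open>z w = 1\<close>.\<close>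

lemma field1_identities:
  fixes x y z s w a0 a1 :: complex
  assumes "z * w = 1"
  defines "L \<equiv> (2 * (2*a1 - 1) * x + 2*a0) * s^2"
  defines "Y \<equiv> - (y * z + L) * z"
  defines "M \<equiv> Y * w + L"
  defines "K \<equiv> (2*a1 - 1) * (2*a1 - 3) / 2 * s^2 + 2 * s - 4 * x * s + 4 * M * w"
  defines "dz \<equiv> - (1/2) * z^2 - 4 * s * x - 4 * y - 2 * s * z + (2*a1 - 1) * (2*a1 - 3) / 2 * s^2 + 2 * s"
  defines "dy \<equiv> y * z + ((2*a1 - 1) * x + a0) * s^2"
  shows "- M * w = y"
    "K * (Y * w + M) + 2 * (2*a1 - 1) * M * s^2 - 4 * Y * s =
     - (dy * z + y * dz + (2 * (2*a1 - 1) * y * s^2 - 2 * (2 * (2*a1 - 1) * x + 2*a0) * s^3)) * z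
     - (y * z + L) * dz"
    "1/2 + 2 * w * s - w^2 * K = - dz * w^2"
proof -
  have Yw: "Y * w = - (y * z + L)" using assms(1) unfolding Y_def by algebra
  then have M: "M = - y * z" unfolding M_def by simp
  then have Mw: "M * w = - y" using assms(1) by algebra
  then show "- M * w = y" by simp
  have K: "K = dz + 1/2 * z^2 + 2 * s * z"
  proof -
    have "4 * M * w = - 4 * y" using Mw by (simp add: mult.assoc)
    then show ?thesis unfolding K_def dz_def by simp
  qed
  show "1/2 + 2 * w * s - w^2 * K = - dz * w^2" unfolding K using assms(1) by algebra
  show "K * (Y * w + M) + 2 * (2*a1 - 1) * M * s^2 - 4 * Y * s =
     - (dy * z + y * dz + (2 * (2*a1 - 1) * y * s^2 - 2 * (2 * (2*a1 - 1) * x + 2*a0) * s^3)) * z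
     - (y * z + L) * dz"
    unfolding Yw M K unfolding Y_def L_def dy_def by algebra
qed

lemma system_field_push1:
  assumes "p$3 \<noteq> 0" "p$4 \<noteq> 0"
  shows "frechet_derivative (total_change \<alpha>0 \<alpha>1 1) (at p) (system_field \<alpha>0 \<alpha>1 p)
    = field1 \<alpha>0 \<alpha>1 (total_change \<alpha>0 \<alpha>1 1 p)"
proof (rule frechet_derivative_componentwise)
  fix k :: 4
  define s w where "s = 1 / p$4" and "w = 1 / p$3"
  have "p$3 * w = 1" using assms by (simp add: w_def)
  note alg = field1_identities[OF this, where x = "p$1" and y = "p$2" and s = s and ?a0.0 = \<alpha>0 and ?a1.0 = \<alpha>1]
  show "dir_deriv (\<lambda>p. total_change \<alpha>0 \<alpha>1 1 p $ k) p (system_field \<alpha>0 \<alpha>1 p)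
         (field1 \<alpha>0 \<alpha>1 (total_change \<alpha>0 \<alpha>1 1 p) $ k)"
    by (insert exhaust_4[of k], elim disjE; simp only: total_change_1 vector_4;
        (rule dir_deriv_eq, (rule dir_deriv_intros assms)+,
         simp only: system_field_eq field1_def Let_def vector_4 alg flip: s_def w_def))
      (simp add: algebra_simps power2_eq_square power3_eq_cube)
qed

text \<open>As for chart 1. The constants \<open>dE\<close>, \<open>dB\<close>, \<open>dD\<close> are the derivatives of the parts of
  \<open>Y = - (E z - B + D) z\<close> along the system, where \<open>D = (z/4 + s) z\<^sup>2\<close> and \<open>ds/dt = - s\<^sup>2\<close>. What makes
  \<open>M = Y w - L\<close> divisible by \<open>z\<close> is that \<open>L\<close> is \<open>B\<close> with \<open>x\<close> replaced by \<open>X = x + z/2\<close>, so that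
  \<open>B - L\<close> is a multiple of \<open>z\<close>.\<close>

lemma field2_identities:
  fixes x y z s w a0 a1 :: complex
  assumes "z * w = 1"
  defines "B \<equiv> (2 * (2*a1 - 3) * x + 2 * (a0 + 1)) * s^2 + (2*a1 - 1) * (2*a1 - 3) * s^3"
  defines "E \<equiv> y + 2 * s * x - s - (a1^2 - a1 - 7/4) * s^2"
  defines "Y \<equiv> - (E * z - B + (1/4 * z + s) * z^2) * z"
  defines "X \<equiv> x + 1/2 * z"
  defines "L \<equiv> (2 * (2*a1 - 3) * X + 2 * (a0 + 1)) * s^2 + (2*a1 - 1) * (2*a1 - 3) * s^3"
  defines "M \<equiv> Y * w - L"
  defines "K \<equiv> 4 * X * s - 2 * s - (2*a1^2 - 8*a1 + 7/2) * s^2 + 4 * M * w"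
  defines "dz \<equiv> - (1/2) * z^2 - 4 * s * x - 4 * y - 2 * s * z + (2*a1 - 1) * (2*a1 - 3) / 2 * s^2 + 2 * s"
  defines "dy \<equiv> y * z + ((2*a1 - 1) * x + a0) * s^2"
  defines "dB \<equiv> 2 * (2*a1 - 3) * y * s^2 - 2 * (2 * (2*a1 - 3) * x + 2 * (a0 + 1)) * s^3
     - 3 * (2*a1 - 1) * (2*a1 - 3) * s^4"
  defines "dD \<equiv> (1/4 * dz - s^2) * z^2 + (1/4 * z + s) * (2 * z * dz)"
  defines "dE \<equiv> dy + 2 * s * y - 2 * s^2 * x + s^2 + 2 * (a1^2 - a1 - 7/4) * s^3"
  shows "(2*a1 - 1) / 2 * s^2 + M * w = y + 1/2 * dz"
    "K * (Y * w + M) + 2 * (2*a1 - 3) * M * s^2 - 2 * Y * s =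
     - (E * z - B + (1/4 * z + s) * z^2) * dz + - (E * dz + dE * z - dB + dD) * z"
    "- 1/2 - w^2 * K = - dz * w^2"
proof -
  \<comment> \<open>\<open>N\<close> is \<open>- M w\<close>, written without \<open>w\<close>.\<close>
  define N where "N = E + (2*a1 - 3) * s^2 + 1/4 * z^2 + s * z"
  have Yw: "Y * w = - (E * z - B + (1/4 * z + s) * z^2)" using assms(1) unfolding Y_def by algebra
  then have M: "M = - N * z"
    unfolding M_def N_def L_def B_def X_def by (simp add: algebra_simps power2_eq_square)
  then have Mw: "M * w = - N" using assms(1) by algebra
  show "(2*a1 - 1) / 2 * s^2 + M * w = y + 1/2 * dz"
    unfolding Mw by (simp add: N_def E_def dz_def field_simps power2_eq_square)
  have K: "K = dz - 1/2 * z^2"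
  proof -
    have M4: "4 * M * w = - 4 * N" using Mw by (simp add: mult.assoc)
    show ?thesis
      unfolding K_def M4 by (simp add: dz_def X_def N_def E_def field_simps power2_eq_square)
  qed
  show "- 1/2 - w^2 * K = - dz * w^2" unfolding K using assms(1) by algebra
  show "K * (Y * w + M) + 2 * (2*a1 - 3) * M * s^2 - 2 * Y * s =
     - (E * z - B + (1/4 * z + s) * z^2) * dz + - (E * dz + dE * z - dB + dD) * z"
    unfolding Yw M K unfolding Y_def N_def dE_def dB_def dD_def B_def E_def dy_def dz_def
    by (simp add: field_simps power2_eq_square power3_eq_cube power4_eq_xxxx)
qed

text \<open>The three parts \<open>E\<close>, \<open>B\<close>, \<open>D\<close> of the second coordinate are differentiated separately; the product
  rule then yields literally the right-hand side of \<open>field2_identities\<close>.\<close>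

lemma system_field_push2:
  assumes "p$3 \<noteq> 0" "p$4 \<noteq> 0"
  shows "frechet_derivative (total_change \<alpha>0 \<alpha>1 2) (at p) (system_field \<alpha>0 \<alpha>1 p)
    = field2 \<alpha>0 \<alpha>1 (total_change \<alpha>0 \<alpha>1 2 p)"
proof (rule frechet_derivative_componentwise)
  fix k :: 4
  define s w where "s = 1 / p$4" and "w = 1 / p$3"
  have "p$3 * w = 1" using assms by (simp add: w_def)
  note alg = field2_identities[OF this, where x = "p$1" and y = "p$2" and s = s and ?a0.0 = \<alpha>0 and ?a1.0 = \<alpha>1]
  define F where "F = system_field \<alpha>0 \<alpha>1 p"
  have F: "F $ 1 = p$2" "F $ 4 = 1"
    "F $ 2 = p$2 * p$3 + ((2*\<alpha>1 - 1) * p$1 + \<alpha>0) * s^2"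
    "F $ 3 = - (1/2) * p$3^2 - 4 * s * p$1 - 4 * p$2 - 2 * s * p$3
       + (2*\<alpha>1 - 1) * (2*\<alpha>1 - 3) / 2 * s^2 + 2 * s"
    by (simp_all only: F_def system_field_eq vector_4 s_def)
  define E B D where "E = (\<lambda>p :: complex^4. p$2 + 2 * (1 / p$4) * p$1 - 1 / p$4
       - (\<alpha>1^2 - \<alpha>1 - 7/4) * (1 / p$4)^2)"
    and "B = (\<lambda>p :: complex^4. (2 * (2*\<alpha>1 - 3) * p$1 + 2 * (\<alpha>0 + 1)) * (1 / p$4)^2
       + (2*\<alpha>1 - 1) * (2*\<alpha>1 - 3) * (1 / p$4)^3)"
    and "D = (\<lambda>p :: complex^4. (1/4 * p$3 + 1 / p$4) * p$3^2)"
  have E: "dir_deriv E p F (F$2 + 2 * s * p$2 - 2 * s^2 * p$1 + s^2 + 2 * (\<alpha>1^2 - \<alpha>1 - 7/4) * s^3)"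
    unfolding E_def
    by (rule dir_deriv_eq, (rule dir_deriv_intros assms)+)
      (simp add: F(1,2) algebra_simps power2_eq_square power3_eq_cube flip: s_def)
  have B: "dir_deriv B p F (2 * (2*\<alpha>1 - 3) * p$2 * s^2 - 2 * (2 * (2*\<alpha>1 - 3) * p$1 + 2 * (\<alpha>0 + 1)) * s^3
     - 3 * (2*\<alpha>1 - 1) * (2*\<alpha>1 - 3) * s^4)"
    unfolding B_def
    by (rule dir_deriv_eq, (rule dir_deriv_intros assms)+)
      (simp add: F(1,2) algebra_simps power2_eq_square power3_eq_cube power4_eq_xxxx flip: s_def)
  have D: "dir_deriv D p F ((1/4 * F$3 - s^2) * p$3^2 + (1/4 * p$3 + s) * (2 * p$3 * F$3))"
    unfolding D_def
    by (rule dir_deriv_eq, (rule dir_deriv_intros assms)+)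
      (simp add: F(2) algebra_simps power2_eq_square flip: s_def)
  define G :: "complex^4 \<Rightarrow> complex^4"
    where "G = (\<lambda>p. vector [p$1 + 1/2 * p$3, - (E p * p$3 - B p + D p) * p$3, 1 / p$3, p$4])"
  have G: "total_change \<alpha>0 \<alpha>1 2 q = G q" if "q$4 \<noteq> 0" for q
    unfolding G_def E_def B_def D_def using that by (rule total_change_2)
  have at_p: "E p = p$2 + 2 * s * p$1 - s - (\<alpha>1^2 - \<alpha>1 - 7/4) * s^2"
    "B p = (2 * (2*\<alpha>1 - 3) * p$1 + 2 * (\<alpha>0 + 1)) * s^2 + (2*\<alpha>1 - 1) * (2*\<alpha>1 - 3) * s^3"
    "D p = (1/4 * p$3 + s) * p$3^2"
    by (simp_all only: E_def B_def D_def s_def)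
  have "dir_deriv (\<lambda>q. G q $ k) p F (field2 \<alpha>0 \<alpha>1 (G p) $ k)"
    by (insert exhaust_4[of k], elim disjE; simp only: G_def vector_4;
        (rule dir_deriv_eq, (rule E B D dir_deriv_intros assms)+,
         simp only: field2_def Let_def vector_4 F at_p alg mult_zero_left add_0_right flip: s_def w_def))
  then have "dir_deriv (\<lambda>q. G q $ k) p F (field2 \<alpha>0 \<alpha>1 (total_change \<alpha>0 \<alpha>1 2 p) $ k)"
    by (simp only: G[OF assms(2)])
  then show "dir_deriv (\<lambda>p. total_change \<alpha>0 \<alpha>1 2 p $ k) p (system_field \<alpha>0 \<alpha>1 p)
         (field2 \<alpha>0 \<alpha>1 (total_change \<alpha>0 \<alpha>1 2 p) $ k)"
    unfolding F_def
    by (rule dir_deriv_transform_within_open[OF _ open_nonzero_coordinate[of 4]]) (use assms G in auto)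
qed
lemma poly_time_field1: "poly_time (\<lambda>p. field1 \<alpha>0 \<alpha>1 p $ k)"
  by (insert exhaust_4[of k], elim disjE; simp only: field1_def Let_def vector_4;
      intro poly_time_intros)

lemma poly_time_field2: "poly_time (\<lambda>p. field2 \<alpha>0 \<alpha>1 p $ k)"
  by (insert exhaust_4[of k], elim disjE; simp only: field2_def Let_def vector_4;
      intro poly_time_intros)

lemma poly_time_system_field: "poly_time (\<lambda>p. system_field \<alpha>0 \<alpha>1 p $ k)"
  by (insert exhaust_4[of k], elim disjE; simp only: system_field_eq vector_4;
      intro poly_time_intros)

section \<open>Coordinate changes of the total space\<close>

definition total_inverse :: "complex \<Rightarrow> complex \<Rightarrow> nat \<Rightarrow> complex^4 \<Rightarrow> complex^4" where
  "total_inverse \<alpha>0 \<alpha>1 j p = with_time (change_inverse \<alpha>0 \<alpha>1 j (p$4) (fibre_part p)) (p$4)"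

text \<open>The part of every copy along which the copies are glued. It is described by the same
  inequality in all charts, because the third coordinate is \<open>z\<close> or \<open>1/z\<close>.\<close>

definition overlap_space :: "(complex^4) set" where
  "overlap_space = {p \<in> chart_space. p$3 \<noteq> 0}"

lemma open_chart_space: "open chart_space"
  unfolding chart_space_def by (rule open_nonzero_coordinate)

lemma open_overlap_space: "open overlap_space"
proof -
  have eq: "overlap_space = {p. p$4 \<noteq> 0} \<inter> {p. p$3 \<noteq> 0}"
    by (auto simp: overlap_space_def chart_space_def)
  show ?thesis unfolding eq by (intro open_Int open_nonzero_coordinate)
qed

lemma fibre_part_with_time: "fibre_part (with_time v t) = v"
  by (simp add: fibre_part_def with_time_def vec_eq_iff forall_3)

lemma with_time_fibre_part: "with_time (fibre_part p) (p$4) = p"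
  by (simp add: fibre_part_def with_time_def vec_eq_iff forall_4)

lemma with_time_nth: "with_time v t $ 3 = v $ 3" "with_time v t $ 4 = t"
  by (simp_all add: with_time_def)

lemma fibre_part_nth: "fibre_part p $ 3 = p $ 3"
  by (simp add: fibre_part_def)

lemma total_change_time: "total_change \<alpha>0 \<alpha>1 j p $ 4 = p $ 4"
  by (simp add: total_change_def with_time_nth)

lemma total_change_overlap: "p \<in> overlap_space \<Longrightarrow> total_change \<alpha>0 \<alpha>1 j p \<in> overlap_space"
  by (simp add: overlap_space_def chart_space_def total_change_def with_time_nth fibre_part_nth change_nonzero)

lemma total_inverse_overlap: "p \<in> overlap_space \<Longrightarrow> total_inverse \<alpha>0 \<alpha>1 j p \<in> overlap_space"
  by (simp add: overlap_space_def chart_space_def total_inverse_def with_time_nth fibre_part_nth change_inverse_nonzero)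

lemma total_inverse_change:
  "p \<in> overlap_space \<Longrightarrow> total_inverse \<alpha>0 \<alpha>1 j (total_change \<alpha>0 \<alpha>1 j p) = p"
  by (simp add: overlap_space_def chart_space_def total_change_def total_inverse_def with_time_nth
      fibre_part_with_time fibre_part_nth change_inverse_change with_time_fibre_part)

lemma total_change_inverse:
  "p \<in> overlap_space \<Longrightarrow> total_change \<alpha>0 \<alpha>1 j (total_inverse \<alpha>0 \<alpha>1 j p) = p"
  by (simp add: overlap_space_def chart_space_def total_change_def total_inverse_def with_time_nth
      fibre_part_with_time fibre_part_nth change_change_inverse with_time_fibre_part)

lemma total_inverse_0: "total_inverse \<alpha>0 \<alpha>1 0 p = p"
  by (simp add: total_inverse_def change_inverse_def with_time_fibre_part)

lemma total_inverse_1: "total_inverse \<alpha>0 \<alpha>1 1 p = total_change \<alpha>0 \<alpha>1 1 p"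
  by (simp add: total_inverse_def change_inverse_def total_change_def change_def)

lemma total_inverse_2:
  "total_inverse \<alpha>0 \<alpha>1 2 p = vector [p$1 - 1/2 * (1 / p$3),
     ((2 * (2*\<alpha>1 - 3) * (p$1 - 1/2 * (1 / p$3)) + 2 * (\<alpha>0 + 1)) * (1/p$4)^2
        + (2*\<alpha>1 - 1) * (2*\<alpha>1 - 3) * (1/p$4)^3
        - (1/4 * (1 / p$3) + 1/p$4) * (1 / p$3)^2 - p$2 * p$3) * p$3
      - (2 * (1/p$4) * (p$1 - 1/2 * (1 / p$3)) - 1/p$4 - (\<alpha>1^2 - \<alpha>1 - 7/4) * (1/p$4)^2),
     1 / p$3, p$4]"
  by (simp add: total_inverse_def change_inverse_def change2_inverse_def with_time_def fibre_part_def
      Let_def mult.commute)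

lemma holomorphic_total_change_1:
  "holomorphic_map_on (total_change \<alpha>0 \<alpha>1 1) overlap_space"
proof (rule holomorphic_map_onI[OF open_overlap_space])
  fix p k assume "p \<in> overlap_space"
  then have nz: "p$3 \<noteq> 0" "p$4 \<noteq> 0" by (auto simp: overlap_space_def chart_space_def)
  show "\<exists>d. dir_deriv (\<lambda>p. total_change \<alpha>0 \<alpha>1 1 p $ k) p 0 d"
    by (insert exhaust_4[of k], elim disjE; simp only: total_change_1 vector_4;
        (rule exI, (rule dir_deriv_intros nz)+))
qed

lemma holomorphic_total_inverse_2:
  "holomorphic_map_on (total_inverse \<alpha>0 \<alpha>1 2) overlap_space"
proof (rule holomorphic_map_onI[OF open_overlap_space])
  fix p k assume "p \<in> overlap_space"
  then have nz: "p$3 \<noteq> 0" "p$4 \<noteq> 0" by (auto simp: overlap_space_def chart_space_def)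
  show "\<exists>d. dir_deriv (\<lambda>p. total_inverse \<alpha>0 \<alpha>1 2 p $ k) p 0 d"
    by (insert exhaust_4[of k], elim disjE; simp only: total_inverse_2 vector_4;
        (rule exI, (rule dir_deriv_intros nz)+))
qed

lemma holomorphic_total_change_2:
  "holomorphic_map_on (total_change \<alpha>0 \<alpha>1 2) overlap_space"
proof (rule holomorphic_map_on_cong)
  let ?G = "\<lambda>p :: complex^4. vector [p$1 + 1/2 * p$3,
     - ((p$2 + 2 * (1 / p$4) * p$1 - 1 / p$4 - (\<alpha>1^2 - \<alpha>1 - 7/4) * (1 / p$4)^2) * p$3
        - ((2 * (2*\<alpha>1 - 3) * p$1 + 2 * (\<alpha>0 + 1)) * (1 / p$4)^2
            + (2*\<alpha>1 - 1) * (2*\<alpha>1 - 3) * (1 / p$4)^3)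
        + (1/4 * p$3 + 1 / p$4) * p$3^2) * p$3, 1 / p$3, p$4] :: complex^4"
  show "?G p = total_change \<alpha>0 \<alpha>1 2 p" if "p \<in> overlap_space" for p
    using that by (subst total_change_2) (auto simp: overlap_space_def chart_space_def)
  show "holomorphic_map_on ?G overlap_space"
  proof (rule holomorphic_map_onI[OF open_overlap_space])
    fix p k assume "p \<in> overlap_space"
    then have nz: "p$3 \<noteq> 0" "p$4 \<noteq> 0" by (auto simp: overlap_space_def chart_space_def)
    show "\<exists>d. dir_deriv (\<lambda>p. ?G p $ k) p 0 d"
      by (insert exhaust_4[of k], elim disjE; simp only: vector_4;
        (rule exI, (rule dir_deriv_intros nz)+))
  qed
qed

lemma holomorphic_total_change:
  "j \<in> indices \<Longrightarrow> holomorphic_map_on (total_change \<alpha>0 \<alpha>1 j) overlap_space"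
  using holomorphic_total_change_1 holomorphic_total_change_2
    holomorphic_map_on_id[OF open_overlap_space]
  by (auto simp: indices_def total_change_0[abs_def] simp del: One_nat_def)

lemma holomorphic_total_inverse:
  "j \<in> indices \<Longrightarrow> holomorphic_map_on (total_inverse \<alpha>0 \<alpha>1 j) overlap_space"
  using holomorphic_total_change_1[of \<alpha>0 \<alpha>1] holomorphic_total_inverse_2
    holomorphic_map_on_id[OF open_overlap_space]
  by (auto simp: indices_def total_inverse_0[abs_def] total_inverse_1[abs_def] simp del: One_nat_def)

section \<open>Separation of the charts\<close>

text \<open>If the third coordinate in the first chart times a continuous function \<open>h\<close> of both coordinate
  vectors is 1 on the overlap, then near a point with third coordinate 0 this product is not 1.\<close>

lemma separated_of_continuous:
  fixes h :: "(complex^4) \<times> (complex^4) \<Rightarrow> complex"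
  assumes "continuous_on UNIV h" "\<And>r. r \<in> overlap_space \<Longrightarrow> f r $ 3 * h (f r, g r) = 1"
    and "p$3 = 0"
  shows "\<exists>A B. open A \<and> open B \<and> p \<in> A \<and> q \<in> B \<and> (\<forall>r\<in>overlap_space. \<not> (f r \<in> A \<and> g r \<in> B))"
proof -
  have "open {x :: (complex^4) \<times> (complex^4). fst x $ 3 * h x \<noteq> 1}"
    using assms(1) by (intro open_Collect_neq continuous_intros)
  then obtain A B where "open A" "open B" "(p, q) \<in> A \<times> B" "A \<times> B \<subseteq> {x. fst x $ 3 * h x \<noteq> 1}"
    using assms(3) by (elim open_prod_elim[where x = "(p, q)"]) auto
  then show ?thesis using assms(2) by (intro exI[of _ A] exI[of _ B]) auto
qed

text \<open>The function \<open>h\<close> is the inverse of the third coordinate of the first chart: it is the third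
  coordinate of the other chart if one of the two is chart 0; between charts 1 and 2, \<open>x\<^sub>2 - x\<^sub>1 = z/2\<close> and
  \<open>z\<^sub>1 = z\<^sub>2 = 1/z\<close>.\<close>

lemma separated_charts:
  assumes "j \<in> indices" "k \<in> indices" "j \<noteq> k" "p \<in> chart_space - overlap_space"
  shows "\<exists>A B. open A \<and> open B \<and> p \<in> A \<and> q \<in> B \<and>
    (\<forall>r\<in>overlap_space. \<not> (total_change \<alpha>0 \<alpha>1 j r \<in> A \<and> total_change \<alpha>0 \<alpha>1 k r \<in> B))"
proof -
  have p: "p$3 = 0" using assms(4) by (auto simp: overlap_space_def)
  consider "j = 0" "k \<noteq> 0" | "j \<noteq> 0" "k = 0" | "j = 1" "k = 2" | "j = 2" "k = 1"
    using assms(1-3) by (auto simp: indices_def)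
  then show ?thesis
  proof cases
    case 1
    then show ?thesis using assms(2)
      by (intro separated_of_continuous[where h = "\<lambda>x. snd x $ 3"] p continuous_intros)
        (auto simp: indices_def total_change_0 total_change_1 total_change_2 overlap_space_def chart_space_def
          simp del: One_nat_def)
  next
    case 2
    then show ?thesis using assms(1)
      by (intro separated_of_continuous[where h = "\<lambda>x. snd x $ 3"] p continuous_intros)
        (auto simp: indices_def total_change_0 total_change_1 total_change_2 overlap_space_def chart_space_def
          simp del: One_nat_def)
  next
    case 3
    then show ?thesis
      by (intro separated_of_continuous[where h = "\<lambda>x. 2 * (snd x $ 1 - fst x $ 1)"] p continuous_intros)
        (auto simp: total_change_1 total_change_2 overlap_space_def chart_space_def
          simp del: One_nat_def)
  next
    case 4
    then show ?thesis
      by (intro separated_of_continuous[where h = "\<lambda>x. 2 * (fst x $ 1 - snd x $ 1)"] p continuous_intros)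
        (auto simp: total_change_1 total_change_2 overlap_space_def chart_space_def
          simp del: One_nat_def)
  qed
qed

section \<open>The phase space\<close>

interpretation phase: gluing indices chart_space overlap_space "total_change \<alpha>0 \<alpha>1" "total_inverse \<alpha>0 \<alpha>1"
  for \<alpha>0 \<alpha>1
proof
  show "countable indices" by (simp add: indices_def)
  show "open chart_space" by (rule open_chart_space)
  show "overlap_space \<subseteq> chart_space" by (auto simp: overlap_space_def)
qed (rule holomorphic_total_change holomorphic_total_inverse total_change_overlap
  total_inverse_overlap total_inverse_change total_change_inverse separated_charts; assumption)+

lemma glue_eq: "glue \<alpha>0 \<alpha>1 = phase.rel \<alpha>0 \<alpha>1"
  unfolding glue_def phase.rel_def by (auto simp: overlap_space_def)

lemma phase_space_eq: "phase_space \<alpha>0 \<alpha>1 = phase.glued \<alpha>0 \<alpha>1"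
  by (simp add: phase_space_def phase.glued_def glue_eq)

lemma chart_dom_eq: "chart_dom \<alpha>0 \<alpha>1 = phase.patch \<alpha>0 \<alpha>1"
  by (simp add: fun_eq_iff chart_dom_def phase.patch_def phase.pt_def glue_eq)

lemma chart_map_eq: "chart_map = phase.chart"
  by (simp add: fun_eq_iff chart_map_def phase.chart_def)

text \<open>All coordinate changes leave \<open>t\<close> fixed, so every representative of a point has the same last
  coordinate.\<close>

lemma time_proj_pt:
  assumes "j \<in> indices" "p \<in> chart_space"
  shows "time_proj (phase.pt \<alpha>0 \<alpha>1 j p) = p $ 4"
proof -
  let ?c = "phase.pt \<alpha>0 \<alpha>1 j p"
  have "\<forall>(k, q)\<in>?c. q $ 4 = p $ 4"
    by (auto simp: phase.pt_def phase.rel_def total_change_time)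
  moreover have "(j, p) \<in> ?c"
    using assms by (simp add: phase.pt_def phase.rel_same_chart)
  then have "t = p $ 4" if "\<forall>(k, q)\<in>?c. q $ 4 = t" for t
    using that by fastforce
  ultimately show ?thesis unfolding time_proj_def by (rule the_equality)
qed

lemma time_submersion:
  "holomorphic_submersion_onto (phase.glued \<alpha>0 \<alpha>1) indices (phase.patch \<alpha>0 \<alpha>1) phase.chart time_proj (- {0})"
  unfolding holomorphic_submersion_onto_def
proof (intro conjI ballI)
  have "t \<in> time_proj ` topspace (phase.glued \<alpha>0 \<alpha>1)" if "t \<noteq> 0" for t
  proof -
    have "axis 4 t \<in> chart_space" "0 \<in> indices" using that by (auto simp: chart_space_def indices_def)
    then have "phase.pt \<alpha>0 \<alpha>1 0 (axis 4 t) \<in> topspace (phase.glued \<alpha>0 \<alpha>1)"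
      and "t = time_proj (phase.pt \<alpha>0 \<alpha>1 0 (axis 4 t))"
      using phase.Union_patch[of \<alpha>0 \<alpha>1] by (auto simp: phase.patch_def time_proj_pt)
    then show ?thesis by (rule rev_image_eqI)
  qed
  moreover have "time_proj c \<noteq> 0" if "c \<in> topspace (phase.glued \<alpha>0 \<alpha>1)" for c
  proof -
    have "c \<in> (\<Union>j\<in>indices. phase.patch \<alpha>0 \<alpha>1 j)" using that by (simp only: phase.Union_patch)
    then obtain j p where "j \<in> indices" "p \<in> chart_space" "c = phase.pt \<alpha>0 \<alpha>1 j p"
      unfolding phase.patch_def by (elim UN_E imageE)
    then show ?thesis by (simp add: time_proj_pt) (simp add: chart_space_def)
  qed
  ultimately show "time_proj ` topspace (phase.glued \<alpha>0 \<alpha>1) = - {0}" by auto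
next
  fix j p assume j: "j \<in> indices" and "p \<in> phase.chart j ` phase.patch \<alpha>0 \<alpha>1 j"
  then have p: "p \<in> chart_space" by (simp add: phase.chart_patch)
  have "((\<lambda>p :: complex^4. p $ 4) has_derivative (\<lambda>v. v $ 4)) (at p)"
    by (rule bounded_linear_imp_has_derivative) (rule bounded_linear_vec_nth)
  then have "(time_proj \<circ> inv_into (phase.patch \<alpha>0 \<alpha>1 j) (phase.chart j) has_derivative (\<lambda>v. v $ 4)) (at p)"
    by (rule has_derivative_transform_within_open[OF _ open_chart_space p])
      (simp add: phase.inv_into_chart time_proj_pt j)
  moreover have "surj (\<lambda>v :: complex^4. v $ 4)"
    by (rule surjI[of _ "axis 4"]) simp
  ultimately show "\<exists>D. (time_proj \<circ> inv_into (phase.patch \<alpha>0 \<alpha>1 j) (phase.chart j) has_derivative D) (at p) \<and>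
      (\<forall>c v. D (c *s v) = c * D v) \<and> surj D"
    by (intro exI[of _ "\<lambda>v. v $ 4"]) simp
qed

section \<open>The extended vector field\<close>

definition extended_field :: "complex \<Rightarrow> complex \<Rightarrow> nat \<Rightarrow> complex^4 \<Rightarrow> complex^4" where
  "extended_field \<alpha>0 \<alpha>1 j =
     (if j = 0 then system_field \<alpha>0 \<alpha>1 else if j = 1 then field1 \<alpha>0 \<alpha>1 else field2 \<alpha>0 \<alpha>1)"

lemma holomorphic_extended_field:
  "holomorphic_map_on (extended_field \<alpha>0 \<alpha>1 j) chart_space"
proof (rule holomorphic_map_onI[OF open_chart_space])
  fix p k assume "p \<in> chart_space"
  then have nz: "p$4 \<noteq> 0" by (simp add: chart_space_def)
  have "\<exists>d. dir_deriv (\<lambda>p. system_field \<alpha>0 \<alpha>1 p $ k) p 0 d"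
    by (insert exhaust_4[of k], elim disjE; simp only: system_field_eq vector_4;
        (rule exI, (rule dir_deriv_intros nz)+))
  moreover have "\<exists>d. dir_deriv (\<lambda>p. field1 \<alpha>0 \<alpha>1 p $ k) p 0 d"
    by (insert exhaust_4[of k], elim disjE; simp only: field1_def Let_def vector_4;
        (rule exI, (rule dir_deriv_intros nz)+))
  moreover have "\<exists>d. dir_deriv (\<lambda>p. field2 \<alpha>0 \<alpha>1 p $ k) p 0 d"
    by (insert exhaust_4[of k], elim disjE; simp only: field2_def Let_def vector_4;
        (rule exI, (rule dir_deriv_intros nz)+))
  ultimately show "\<exists>d. dir_deriv (\<lambda>p. extended_field \<alpha>0 \<alpha>1 j p $ k) p 0 d"
    by (simp add: extended_field_def)
qed

lemma extended_field_push:
  assumes "j \<in> indices" "r \<in> overlap_space"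
  shows "extended_field \<alpha>0 \<alpha>1 j (total_change \<alpha>0 \<alpha>1 j r)
    = frechet_derivative (total_change \<alpha>0 \<alpha>1 j) (at r) (system_field \<alpha>0 \<alpha>1 r)"
proof -
  have "frechet_derivative (total_change \<alpha>0 \<alpha>1 0) (at r) = (\<lambda>v. v)"
    by (simp add: total_change_0[abs_def] frechet_derivative_at[OF has_derivative_ident, symmetric])
  then show ?thesis
    using assms system_field_push1[of r \<alpha>0 \<alpha>1] system_field_push2[of r \<alpha>0 \<alpha>1]
    by (auto simp: extended_field_def indices_def overlap_space_def chart_space_def total_change_0
        simp del: One_nat_def)
qed

lemma holomorphic_vector_field_extended:
  "holomorphic_vector_field indices (phase.patch \<alpha>0 \<alpha>1) phase.chart (extended_field \<alpha>0 \<alpha>1)"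
  by (rule phase.holomorphic_vector_fieldI[OF holomorphic_extended_field extended_field_push])

lemma polynomial_extended_field: "polynomial_over_time (\<lambda>p. extended_field \<alpha>0 \<alpha>1 j p $ k)"
  by (simp add: extended_field_def poly_time_imp_polynomial_over_time poly_time_system_field
      poly_time_field1 poly_time_field2)

lemma extended_field_time: "extended_field \<alpha>0 \<alpha>1 j p $ 4 = 1"
  by (simp add: extended_field_def system_field_eq field1_def field2_def Let_def)

theorem theorem4p1:
  fixes \<alpha>0 \<alpha>1 :: complex
  shows
    \<comment> \<open>the transformations are birational, isomorphisms off \<open>z = 0\<close>, and define a gluing\<close>
    "(\<forall>t. t \<noteq> 0 \<longrightarrow> (\<forall>i\<in>{1, 2}. isomorphism_off_z (change \<alpha>0 \<alpha>1 i t))) \<and>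
     equiv (indices \<times> chart_space) (glue \<alpha>0 \<alpha>1) \<and>
     topspace (phase_space \<alpha>0 \<alpha>1) = (indices \<times> chart_space) // glue \<alpha>0 \<alpha>1 \<and>
     \<comment> \<open>the result is a complex manifold over \<open>\<complex>\<^sup>*\<close> with the three copies as charts\<close>
     complex_manifold (phase_space \<alpha>0 \<alpha>1) indices (chart_dom \<alpha>0 \<alpha>1) chart_map \<and>
     (\<forall>j\<in>indices. chart_map j ` chart_dom \<alpha>0 \<alpha>1 j = chart_space \<and>
        (\<forall>c\<in>chart_dom \<alpha>0 \<alpha>1 j. time_proj c = chart_map j c $ 4)) \<and>
     holomorphic_submersion_onto (phase_space \<alpha>0 \<alpha>1) indices (chart_dom \<alpha>0 \<alpha>1) chart_map time_proj (- {0}) \<and>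
     (\<forall>i\<in>{1, 2}.
        chart_map 0 ` (chart_dom \<alpha>0 \<alpha>1 0 \<inter> chart_dom \<alpha>0 \<alpha>1 i) = {p \<in> chart_space. p$3 \<noteq> 0} \<and>
        chart_map i ` (chart_dom \<alpha>0 \<alpha>1 0 \<inter> chart_dom \<alpha>0 \<alpha>1 i) = {p \<in> chart_space. p$3 \<noteq> 0} \<and>
        (\<forall>p\<in>chart_space. p$3 \<noteq> 0 \<longrightarrow>
           transition (chart_dom \<alpha>0 \<alpha>1) chart_map 0 i p = total_change \<alpha>0 \<alpha>1 i p)) \<and>
     \<comment> \<open>the system extends to a holomorphic vector field, polynomial in each chart\<close>
     (\<exists>V. holomorphic_vector_field indices (chart_dom \<alpha>0 \<alpha>1) chart_map V \<and>
        (\<forall>p\<in>chart_space. V 0 p = system_field \<alpha>0 \<alpha>1 p) \<and>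
        (\<forall>j\<in>indices. (\<forall>p\<in>chart_space. V j p $ 4 = 1) \<and>
           (\<forall>k\<in>{1, 2, 3}. polynomial_over_time (\<lambda>p. V j p $ k)))) \<and>
     \<comment> \<open>the coordinate changes preserve the volume form of each fibre\<close>
     (\<forall>t. t \<noteq> 0 \<longrightarrow> (\<forall>i\<in>{1, 2}. \<forall>p. p$3 \<noteq> 0 \<longrightarrow>
        volume_form (change \<alpha>0 \<alpha>1 i t) p = volume_form (\<lambda>v. v) p))"
  unfolding glue_eq phase_space_eq chart_dom_eq chart_map_eq
proof (intro conjI)
  show "\<forall>t. t \<noteq> 0 \<longrightarrow> (\<forall>i\<in>{1, 2}. isomorphism_off_z (change \<alpha>0 \<alpha>1 i t))"
    using isomorphism_off_z_change by blast
  show "equiv (indices \<times> chart_space) (phase.rel \<alpha>0 \<alpha>1)" by (rule phase.equiv_rel)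
  show "topspace (phase.glued \<alpha>0 \<alpha>1) = (indices \<times> chart_space) // phase.rel \<alpha>0 \<alpha>1"
    by (rule phase.topspace_glued)
  show "complex_manifold (phase.glued \<alpha>0 \<alpha>1) indices (phase.patch \<alpha>0 \<alpha>1) phase.chart"
    by (rule phase.complex_manifold_glued)
  show "holomorphic_submersion_onto (phase.glued \<alpha>0 \<alpha>1) indices (phase.patch \<alpha>0 \<alpha>1) phase.chart time_proj (- {0})"
    by (rule time_submersion)
  show "\<forall>j\<in>indices. phase.chart j ` phase.patch \<alpha>0 \<alpha>1 j = chart_space \<and>
      (\<forall>c\<in>phase.patch \<alpha>0 \<alpha>1 j. time_proj c = phase.chart j c $ 4)"
    by (simp add: phase.chart_patch) (simp add: phase.patch_def time_proj_pt phase.chart_pt)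
  show "\<forall>i\<in>{1, 2}.
        phase.chart 0 ` (phase.patch \<alpha>0 \<alpha>1 0 \<inter> phase.patch \<alpha>0 \<alpha>1 i) = {p \<in> chart_space. p$3 \<noteq> 0} \<and>
        phase.chart i ` (phase.patch \<alpha>0 \<alpha>1 0 \<inter> phase.patch \<alpha>0 \<alpha>1 i) = {p \<in> chart_space. p$3 \<noteq> 0} \<and>
        (\<forall>p\<in>chart_space. p$3 \<noteq> 0 \<longrightarrow>
           transition (phase.patch \<alpha>0 \<alpha>1) phase.chart 0 i p = total_change \<alpha>0 \<alpha>1 i p)"
  proof
    fix i :: nat assume "i \<in> {1, 2}"
    then have i: "0 \<in> indices" "i \<in> indices" "i \<noteq> 0" by (auto simp: indices_def)
    show "phase.chart 0 ` (phase.patch \<alpha>0 \<alpha>1 0 \<inter> phase.patch \<alpha>0 \<alpha>1 i) = {p \<in> chart_space. p$3 \<noteq> 0} \<and>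
        phase.chart i ` (phase.patch \<alpha>0 \<alpha>1 0 \<inter> phase.patch \<alpha>0 \<alpha>1 i) = {p \<in> chart_space. p$3 \<noteq> 0} \<and>
        (\<forall>p\<in>chart_space. p$3 \<noteq> 0 \<longrightarrow>
           transition (phase.patch \<alpha>0 \<alpha>1) phase.chart 0 i p = total_change \<alpha>0 \<alpha>1 i p)"
      unfolding overlap_space_def[symmetric]
      using i phase.chart_overlap[OF i(1,2), of \<alpha>0 \<alpha>1] phase.chart_overlap[OF i(2,1), of \<alpha>0 \<alpha>1]
        phase.transition_eq[OF i(1,2), of _ \<alpha>0 \<alpha>1]
      by (simp add: Int_commute overlap_space_def total_inverse_0)
  qed
  show "\<exists>V. holomorphic_vector_field indices (phase.patch \<alpha>0 \<alpha>1) phase.chart V \<and>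
        (\<forall>p\<in>chart_space. V 0 p = system_field \<alpha>0 \<alpha>1 p) \<and>
        (\<forall>j\<in>indices. (\<forall>p\<in>chart_space. V j p $ 4 = 1) \<and>
           (\<forall>k\<in>{1, 2, 3}. polynomial_over_time (\<lambda>p. V j p $ k)))"
    by (intro exI[of _ "extended_field \<alpha>0 \<alpha>1"] conjI ballI holomorphic_vector_field_extended
        polynomial_extended_field extended_field_time) (simp add: extended_field_def)
  show "\<forall>t. t \<noteq> 0 \<longrightarrow> (\<forall>i\<in>{1, 2}. \<forall>p. p$3 \<noteq> 0 \<longrightarrow>
        volume_form (change \<alpha>0 \<alpha>1 i t) p = volume_form (\<lambda>v. v) p)"
    by (simp add: change_def volume_form_change1 volume_form_change2)
qed

end
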